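(* Let $X$ be a pointed metric space, $E$ a Banach space and $\alpha$ a Lipschitz cross-norm on $X\boxtimes E$. Then $\mathrm{Lip}_\alpha(X,E^* )$ (with the norm $\mathrm{Lip}_\alpha$) is isometrically isomorphic to $(X\widehat{\boxtimes}_\alpha E)^*$, via the map $\Lambda\colon\mathrm{Lip}_\alpha(X,E^* )\to (X\widehat{\boxtimes}_\alpha E)^*$ defined by $$\Lambda(f)(u)=\sum_{i=1}^n\left\langle f(x_i)-f(y_i),e_i\right\rangle$$ for $f\in\mathrm{Lip}_\alpha(X,E^* )$ and $u=\sum_{i=1}^n \delta_{(x_i,y_i)}\boxtimes e_i\in X\boxtimes E$. Its inverse $\Lambda^{-1}\colon (X\widehat{\boxtimes}_\alpha E)^*\to\mathrm{Lip}_\alpha(X,E^* )$ is the map given by $$\left\langle \Lambda^{-1}(\varphi)(x),e\right\rangle=\varphi(\delta_{(x,0)}\boxtimes e)$$ for $\varphi\in (X\widehat{\boxtimes}_\alpha E)^*$, $x\in X$ and $e\in E$.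
   Context: A pointed metric space $X$ is a metric space with metric $d$ and a designated base point $0$; a normed space (over $\mathbb K=\mathbb R$ or $\mathbb C$) is pointed by its zero vector. $\mathrm{Lip}_0(X,E^* )$ is the space of all base-point preserving Lipschitz maps from $X$ to the topological dual $E^*$. The Lipschitz tensor product $X\boxtimes E$ is the linear span of all linear functionals $\delta_{(x,y)}\boxtimes e$ on $\mathrm{Lip}_0(X,E^* )$ of the form $(\delta_{(x,y)}\boxtimes e)(f)=\langle f(x)-f(y),e\rangle$, for $x,y\in X$ and $e\in E$. A norm $\alpha$ on $X\boxtimes E$ is a Lipschitz cross-norm if $\alpha(\delta_{(x,y)}\boxtimes e)=d(x,y)\|e\|$ for all $x,y\in X$, $e\in E$. $X\boxtimes_\alpha E$ is $X\boxtimes E$ with the norm $\alpha$ and $X\widehat\boxtimes_\alpha E$ is its completion; a bounded functional given on $X\boxtimes_\alpha E$ is understood to be extended by continuity to the completion. A base-point preserving map $f\colon X\to E^*$ is an $\alpha$-Lipschitz operator if there is $C\ge 0$ with $\left|\sum_{i=1}^n\langle f(x_i)-f(y_i),e_i\rangle\right|\le C\,\alpha\left(\sum_{i=1}^n\delta_{(x_i,y_i)}\boxtimes e_i\right)$ for all $\sum_{i=1}^n\delta_{(x_i,y_i)}\boxtimes e_i\in X\boxtimes E$; the infimum of such $C$ is $\mathrm{Lip}_\alpha(f)$, and $\mathrm{Lip}_\alpha(X,E^* )$ is the set of all $\alpha$-Lipschitz operators from $X$ to $E^*$. *)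

theory Defs
  imports "HOL-Analysis.Analysis" "HOL-Library.Function_Algebras"
begin

text \<open>
  The scalar field is a type \<open>'k :: {real_normed_field, banach}\<close>.  By the Gelfand--Mazur theorem
  the members of this class are, up to isometric isomorphism, exactly \<open>\<real>\<close> and \<open>\<complex>\<close>.

  Normed spaces are given by a carrier \<open>V\<close> inside a \<open>'k\<close>-vector space with scalar
  multiplication \<open>s\<close>, and a norm \<open>N\<close> of which only the values on \<open>V\<close> matter.
\<close>

definition normed_space ::
    "('k::real_normed_field \<Rightarrow> 'v::ab_group_add \<Rightarrow> 'v) \<Rightarrow> 'v set \<Rightarrow> ('v \<Rightarrow> real) \<Rightarrow> bool" where
  "normed_space s V N \<longleftrightarrow>
     vector_space s \<and> module.subspace s V \<and>
     (\<forall>v\<in>V. 0 \<le> N v) \<and>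
     (\<forall>v\<in>V. N v = 0 \<longleftrightarrow> v = 0) \<and>
     (\<forall>u\<in>V. \<forall>v\<in>V. N (u + v) \<le> N u + N v) \<and>
     (\<forall>c. \<forall>v\<in>V. N (s c v) = norm c * N v)"

text \<open>
  The metric induced by the norm; the locale \<open>Metric_space\<close> asks for nonnegativity and symmetry
  outside the carrier too, hence the value \<open>0\<close> there.
\<close>

definition norm_dist :: "'v::ab_group_add set \<Rightarrow> ('v \<Rightarrow> real) \<Rightarrow> 'v \<Rightarrow> 'v \<Rightarrow> real" where
  "norm_dist V N u v = (if u \<in> V \<and> v \<in> V then N (u - v) else 0)"

definition banach_space ::
    "('k::real_normed_field \<Rightarrow> 'v::ab_group_add \<Rightarrow> 'v) \<Rightarrow> 'v set \<Rightarrow> ('v \<Rightarrow> real) \<Rightarrow> bool" where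
  "banach_space s V N \<longleftrightarrow>
     normed_space s V N \<and> Metric_space.mcomplete V (norm_dist V N)"

definition linear_map_on ::
    "('k \<Rightarrow> 'v::ab_group_add \<Rightarrow> 'v) \<Rightarrow> ('k \<Rightarrow> 'w::ab_group_add \<Rightarrow> 'w) \<Rightarrow> 'v set \<Rightarrow> ('v \<Rightarrow> 'w) \<Rightarrow> bool" where
  "linear_map_on s s' V T \<longleftrightarrow>
     (\<forall>u\<in>V. \<forall>v\<in>V. T (u + v) = T u + T v) \<and> (\<forall>c. \<forall>v\<in>V. T (s c v) = s' c (T v))"

definition isometric_isomorphism ::
    "('k::real_normed_field \<Rightarrow> 'v::ab_group_add \<Rightarrow> 'v) \<Rightarrow> 'v set \<Rightarrow> ('v \<Rightarrow> real) \<Rightarrow>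
     ('k \<Rightarrow> 'w::ab_group_add \<Rightarrow> 'w) \<Rightarrow> 'w set \<Rightarrow> ('w \<Rightarrow> real) \<Rightarrow> ('v \<Rightarrow> 'w) \<Rightarrow> bool" where
  "isometric_isomorphism s V N s' W N' T \<longleftrightarrow>
     normed_space s V N \<and> normed_space s' W N' \<and>
     linear_map_on s s' V T \<and> bij_betw T V W \<and> (\<forall>v\<in>V. N' (T v) = N v)"

text \<open>
  \<open>\<iota>\<close> exhibits the Banach space \<open>(W, N')\<close> as a completion of the normed space \<open>(V, N)\<close>.
  Completions are unique up to isometric isomorphism; lemma \<open>completion_exists\<close> below shows
  that every normed space has one.
\<close>

definition is_completion ::
    "('k::real_normed_field \<Rightarrow> 'v::ab_group_add \<Rightarrow> 'v) \<Rightarrow> 'v set \<Rightarrow> ('v \<Rightarrow> real) \<Rightarrow>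
     ('k \<Rightarrow> 'w::ab_group_add \<Rightarrow> 'w) \<Rightarrow> 'w set \<Rightarrow> ('w \<Rightarrow> real) \<Rightarrow> ('v \<Rightarrow> 'w) \<Rightarrow> bool" where
  "is_completion s V N s' W N' \<iota> \<longleftrightarrow>
     normed_space s V N \<and> banach_space s' W N' \<and>
     \<iota> ` V \<subseteq> W \<and> linear_map_on s s' V \<iota> \<and> (\<forall>v\<in>V. N' (\<iota> v) = N v) \<and>
     Metric_space.mtopology W (norm_dist W N') closure_of (\<iota> ` V) = W"

text \<open>
  Functionals on a carrier are represented by functions vanishing outside it, so that two
  functionals are equal exactly when they agree on the carrier.
\<close>

definition dual_space ::
    "('k::real_normed_field \<Rightarrow> 'v::ab_group_add \<Rightarrow> 'v) \<Rightarrow> 'v set \<Rightarrow> ('v \<Rightarrow> real) \<Rightarrow> ('v \<Rightarrow> 'k) set" where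
  "dual_space s V N =
     {\<phi>. linear_map_on s (*) V \<phi> \<and> (\<exists>C. \<forall>v\<in>V. norm (\<phi> v) \<le> C * N v) \<and> (\<forall>v. v \<notin> V \<longrightarrow> \<phi> v = 0)}"

definition dual_norm :: "'v set \<Rightarrow> ('v \<Rightarrow> real) \<Rightarrow> ('v \<Rightarrow> 'k::real_normed_field) \<Rightarrow> real" where
  "dual_norm V N \<phi> = (SUP v\<in>{v \<in> V. N v \<le> 1}. norm (\<phi> v))"

definition fun_scale :: "('k \<Rightarrow> 'b \<Rightarrow> 'b) \<Rightarrow> 'k \<Rightarrow> ('a \<Rightarrow> 'b) \<Rightarrow> 'a \<Rightarrow> 'b" where
  "fun_scale s c f = (\<lambda>x. s c (f x))"

lemma vector_space_fun_scale:
  assumes "vector_space s"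
  shows "vector_space (fun_scale s)"
proof -
  interpret vector_space s by fact
  show ?thesis
    by unfold_locales (auto simp: fun_scale_def scale_right_distrib scale_left_distrib)
qed

lemma completion_exists:
  fixes s :: "'k::real_normed_field \<Rightarrow> 'v::ab_group_add \<Rightarrow> 'v"
  assumes NS: "normed_space s V N"
  shows "\<exists>(W :: (nat \<Rightarrow> 'v) set) N' \<iota>. is_completion s V N (fun_scale s) W N' \<iota>"
proof -
  define S where "S = (fun_scale s :: 'k \<Rightarrow> (nat \<Rightarrow> 'v) \<Rightarrow> _)"
  have vs: "vector_space s" and subV: "module.subspace s V"
    using NS by (auto simp: normed_space_def)
  interpret v: vector_space s by fact
  interpret f: vector_space S unfolding S_def by (rule vector_space_fun_scale) fact
  interpret ff: vector_space_pair S S by unfold_locales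
  have S_app: "S c x n = s c (x n)" for c x n by (simp add: S_def fun_scale_def)
  have V0: "0 \<in> V" and Vadd: "\<And>u v. u \<in> V \<Longrightarrow> v \<in> V \<Longrightarrow> u + v \<in> V"
    and Vsc: "\<And>c v. v \<in> V \<Longrightarrow> s c v \<in> V" and Vdiff: "\<And>u v. u \<in> V \<Longrightarrow> v \<in> V \<Longrightarrow> u - v \<in> V"
    using subV by (auto intro: v.subspace_0 v.subspace_add v.subspace_scale v.subspace_diff)
  have Nnn: "0 \<le> N v" and N0: "N v = 0 \<longleftrightarrow> v = 0" and Nsc: "N (s c v) = norm c * N v"
    if "v \<in> V" for v c using NS that by (auto simp: normed_space_def)
  have Ntri: "N (u + v) \<le> N u + N v" if "u \<in> V" "v \<in> V" for u v
    using NS that by (auto simp: normed_space_def)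
  have Nmin: "N (u - v) = N (v - u)" if "u \<in> V" "v \<in> V" for u v
  proof -
    have "N (s (-1) (u - v)) = N (u - v)" using Nsc[of "u - v" "-1"] Vdiff that by simp
    then show ?thesis by simp
  qed
  have Ntri3: "N (u - w) \<le> N (u - v) + N (v - w)" if "u \<in> V" "v \<in> V" "w \<in> V" for u v w
    using Ntri[of "u - v" "v - w"] Vdiff that by simp
  have Nrev: "\<bar>N u - N v\<bar> \<le> N (u - v)" if "u \<in> V" "v \<in> V" for u v
    using Ntri[of "u - v" v] Ntri[of "v - u" u] Vdiff Nmin[of u v] that by simp
  define Cau where "Cau = {x. (\<forall>n::nat. x n \<in> V) \<and>
                   (\<forall>\<epsilon>>0. \<exists>M. \<forall>m\<ge>M. \<forall>n\<ge>M. N (x m - x n) < \<epsilon>)}"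
  define Null where "Null = {x. (\<forall>n. x n \<in> V) \<and> (\<lambda>n. N (x n)) \<longlonglongrightarrow> 0}"
  have CauV: "x n \<in> V" if "x \<in> Cau" for x n using that by (auto simp: Cau_def)
  have CauD: "\<exists>M. \<forall>m\<ge>M. \<forall>n\<ge>M. N (x m - x n) < \<epsilon>" if "x \<in> Cau" "\<epsilon> > 0" for x \<epsilon>
    using that by (auto simp: Cau_def)
  have subCau: "f.subspace Cau"
  proof (rule f.subspaceI)
    show "0 \<in> Cau" using N0[OF V0] V0 by (auto simp: Cau_def)
  next
    fix x y assume xy: "x \<in> Cau" "y \<in> Cau"
    have "\<exists>M. \<forall>m\<ge>M. \<forall>n\<ge>M. N ((x + y) m - (x + y) n) < \<epsilon>" if "\<epsilon> > 0" for \<epsilon>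
    proof -
      obtain M1 where M1: "\<And>m n. m \<ge> M1 \<Longrightarrow> n \<ge> M1 \<Longrightarrow> N (x m - x n) < \<epsilon> / 2"
        using CauD[of x "\<epsilon> / 2"] xy \<open>\<epsilon> > 0\<close> by auto
      obtain M2 where M2: "\<And>m n. m \<ge> M2 \<Longrightarrow> n \<ge> M2 \<Longrightarrow> N (y m - y n) < \<epsilon> / 2"
        using CauD[of y "\<epsilon> / 2"] xy \<open>\<epsilon> > 0\<close> by auto
      have "N ((x + y) m - (x + y) n) < \<epsilon>" if "m \<ge> max M1 M2" "n \<ge> max M1 M2" for m n
      proof -
        have "(x + y) m - (x + y) n = (x m - x n) + (y m - y n)" by simp
        then have "N ((x + y) m - (x + y) n) \<le> N (x m - x n) + N (y m - y n)"
          using Ntri Vdiff CauV xy by metis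
        then show ?thesis using M1[of m n] M2[of m n] that by simp
      qed
      then show ?thesis by blast
    qed
    then show "x + y \<in> Cau" using xy Vadd by (auto simp: Cau_def)
  next
    fix c :: 'k and x assume x: "x \<in> Cau"
    have "\<exists>M. \<forall>m\<ge>M. \<forall>n\<ge>M. N (S c x m - S c x n) < \<epsilon>" if "\<epsilon> > 0" for \<epsilon>
    proof -
      have pos: "\<epsilon> / (norm c + 1) > 0" using that by (simp add: add_nonneg_pos)
      then obtain M where M: "\<And>m n. m \<ge> M \<Longrightarrow> n \<ge> M \<Longrightarrow> N (x m - x n) < \<epsilon> / (norm c + 1)"
        using CauD[OF x] by blast
      have "N (S c x m - S c x n) < \<epsilon>" if "m \<ge> M" "n \<ge> M" for m n
      proof -
        have "N (S c x m - S c x n) = norm c * N (x m - x n)"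
          using Nsc[of "x m - x n" c] Vdiff CauV[OF x]
          by (simp add: S_app v.scale_right_diff_distrib)
        also have "\<dots> \<le> (norm c + 1) * N (x m - x n)"
          using Nnn Vdiff CauV[OF x] by (intro mult_right_mono) auto
        also have "\<dots> < (norm c + 1) * (\<epsilon> / (norm c + 1))"
          using M[OF that] by (intro mult_strict_left_mono) (auto simp: add_nonneg_pos)
        also have "\<dots> = \<epsilon>" by (smt (verit) norm_ge_zero nonzero_mult_div_cancel_left times_divide_eq_right)
        finally show ?thesis .
      qed
      then show ?thesis by blast
    qed
    then show "S c x \<in> Cau" using x Vsc by (auto simp: Cau_def S_app)
  qed
  have subNull: "f.subspace Null"
  proof (rule f.subspaceI)
    show "0 \<in> Null" using N0[OF V0] V0 by (auto simp: Null_def)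
  next
    fix x y assume xy: "x \<in> Null" "y \<in> Null"
    then have V: "x n \<in> V" "y n \<in> V" for n by (auto simp: Null_def)
    have "(\<lambda>n. N (x n) + N (y n)) \<longlonglongrightarrow> 0"
      using xy tendsto_add[of "\<lambda>n. N (x n)" 0 _ "\<lambda>n. N (y n)" 0] by (simp add: Null_def)
    then have "(\<lambda>n. N (x n + y n)) \<longlonglongrightarrow> 0"
      by (rule tendsto_sandwich[OF _ _ tendsto_const, rotated 2])
         (use V Vadd Nnn Ntri in auto)
    then show "x + y \<in> Null" using V Vadd by (auto simp: Null_def)
  next
    fix c :: 'k and x assume x: "x \<in> Null"
    then have "(\<lambda>n. norm c * N (x n)) \<longlonglongrightarrow> norm c * 0"
      by (intro tendsto_mult_left) (auto simp: Null_def)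
    then show "S c x \<in> Null" using x Vsc Nsc by (auto simp: Null_def S_app)
  qed
  have NC: "Null \<subseteq> Cau"
  proof
    fix x assume x: "x \<in> Null"
    then have V: "x n \<in> V" for n by (auto simp: Null_def)
    have "\<exists>M. \<forall>m\<ge>M. \<forall>n\<ge>M. N (x m - x n) < \<epsilon>" if "\<epsilon> > 0" for \<epsilon>
    proof -
      obtain M where M: "\<And>n. n \<ge> M \<Longrightarrow> \<bar>N (x n)\<bar> < \<epsilon> / 2"
        using x \<open>\<epsilon> > 0\<close> LIMSEQ_D[of "\<lambda>n. N (x n)" 0 "\<epsilon> / 2"] by (auto simp: Null_def)
      have "N (x m - x n) < \<epsilon>" if "m \<ge> M" "n \<ge> M" for m n
        using Ntri3[of "x m" 0 "x n"] Nmin[of "x n" 0] M[OF that(1)] M[OF that(2)] V V0 by simp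
      then show ?thesis by blast
    qed
    then show "x \<in> Cau" using V by (auto simp: Cau_def)
  qed
  obtain B where B: "B \<subseteq> Null" "f.independent B" "Null \<subseteq> f.span B"
    using f.maximal_independent_subset[of Null] by blast
  obtain B' where B': "B \<subseteq> B'" "B' \<subseteq> Cau" "f.independent B'" "Cau \<subseteq> f.span B'"
    using f.maximal_independent_subset_extend[OF _ B(2), of Cau] B(1) NC by blast
  define p where "p = ff.construct B' (\<lambda>b. if b \<in> B then 0 else b)"
  have plin: "Vector_Spaces.linear S S p"
    unfolding p_def by (rule ff.linear_construct) fact
  interpret p: Vector_Spaces.linear S S p by fact
  note plus_fun_apply [simp del] zero_fun_apply [simp del] minus_apply [simp del] uminus_apply [simp del]
  have pB: "p b = (if b \<in> B then 0 else b)" if "b \<in> B'" for b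
    unfolding p_def using ff.construct_basis[OF B'(3) that] by simp
  have pNull: "p x = 0" if "x \<in> Null" for x
  proof -
    have "x \<in> f.span B" using B(3) that by auto
    then show ?thesis
    proof (induction rule: f.span_induct_alt)
      case base then show ?case by (rule p.zero)
    next
      case (step c x y) then have "p x = 0" using pB B'(1) by auto
      then show ?case using step(2) by (simp add: p.add p.scale)
    qed
  qed
  have pCau: "p x - x \<in> Null" if "x \<in> Cau" for x
  proof -
    have "x \<in> f.span B'" using B'(4) that by auto
    then show ?thesis
    proof (induction rule: f.span_induct_alt)
      case base then show ?case using f.subspace_0[OF subNull] by (simp add: p.zero)
    next
      case (step c x y)
      have "p x - x \<in> Null"
        using pB[OF step(1)] B(1) f.subspace_0[OF subNull] f.subspace_neg[OF subNull, of x] by auto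
      then have "S c (p x - x) + (p y - y) \<in> Null"
        using step(2) subNull f.subspace_add f.subspace_scale by blast
      then show ?case by (simp add: p.add p.scale f.scale_right_diff_distrib algebra_simps)
    qed
  qed
  define W where "W = p ` Cau"
  have WC: "W \<subseteq> Cau"
  proof -
    have "p x \<in> Cau" if "x \<in> Cau" for x
      using f.subspace_add[OF subCau, of "p x - x" x] pCau[OF that] NC that by auto
    then show ?thesis by (auto simp: W_def)
  qed
  have pW: "p w = w" if w: "w \<in> W" for w
  proof -
    from w obtain x where x: "x \<in> Cau" "w = p x" by (auto simp: W_def)
    have "p (p x - x) = 0" using pNull pCau x by blast
    then show ?thesis by (simp add: p.diff x)
  qed
  have subW: "f.subspace W" unfolding W_def using p.subspace_image[OF subCau] .
  define N' where "N' x = lim (\<lambda>n. N (x n))" for x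
  have lim: "(\<lambda>n. N (x n)) \<longlonglongrightarrow> N' x" if x: "x \<in> Cau" for x
  proof -
    have "Cauchy (\<lambda>n. N (x n))"
    proof (rule CauchyI)
      fix \<epsilon> :: real assume "\<epsilon> > 0"
      then obtain M where M: "\<And>m n. m \<ge> M \<Longrightarrow> n \<ge> M \<Longrightarrow> N (x m - x n) < \<epsilon>"
        using CauD[OF x] by blast
      then have "norm (N (x m) - N (x n)) < \<epsilon>" if "m \<ge> M" "n \<ge> M" for m n
        using Nrev[of "x m" "x n"] CauV[OF x] that by (smt (verit) real_norm_def)
      then show "\<exists>M. \<forall>m\<ge>M. \<forall>n\<ge>M. norm (N (x m) - N (x n)) < \<epsilon>" by blast
    qed
    then show ?thesis unfolding N'_def using Cauchy_convergent convergent_LIMSEQ_iff by blast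
  qed
  have N'nn: "0 \<le> N' x" if "x \<in> Cau" for x
    using LIMSEQ_le_const[OF lim[OF that]] Nnn CauV[OF that] by auto
  have N'tri: "N' (x + y) \<le> N' x + N' y" if "x \<in> Cau" "y \<in> Cau" for x y
    using LIMSEQ_le[OF lim[OF f.subspace_add[OF subCau that]] tendsto_add[OF lim[OF that(1)] lim[OF that(2)]]]
      Ntri CauV that by (auto simp: plus_fun_apply)
  have N'sc: "N' (S c x) = norm c * N' x" if x: "x \<in> Cau" for x c
  proof -
    have "(\<lambda>n. N (S c x n)) \<longlonglongrightarrow> norm c * N' x"
      using tendsto_mult_left[OF lim[OF x], of "norm c"] Nsc CauV[OF x] by (simp add: S_app)
    then show ?thesis using LIMSEQ_unique lim f.subspace_scale[OF subCau x] by blast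
  qed
  have N'Null: "N' x = 0" if "x \<in> Null" for x
    using that lim NC LIMSEQ_unique unfolding Null_def by blast
  have N'p: "N' (p x) = N' x" if x: "x \<in> Cau" for x
  proof -
    have d: "p x - x \<in> Null" by (rule pCau[OF x])
    then have d': "x - p x \<in> Null" using f.subspace_neg[OF subNull d] by simp
    have px: "p x \<in> Cau" using WC x by (auto simp: W_def)
    have "N' (p x) \<le> N' x + N' (p x - x)" "N' x \<le> N' (p x) + N' (x - p x)"
      using N'tri[of x "p x - x"] N'tri[of "p x" "x - p x"] x px d d' NC by auto
    then show ?thesis using N'Null d d' by simp
  qed
  have nsW: "normed_space S W N'"
    unfolding normed_space_def
  proof (intro conjI ballI allI)
    show "vector_space S" "f.subspace W" by (fact f.vector_space_axioms subW)+
    fix x assume x: "x \<in> W"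
    then have xC: "x \<in> Cau" using WC by auto
    show "0 \<le> N' x" using N'nn xC .
    show "N' (S c x) = norm c * N' x" for c using N'sc xC .
    show "N' x = 0 \<longleftrightarrow> x = 0"
    proof
      assume "N' x = 0"
      then have "x \<in> Null" using lim[OF xC] CauV[OF xC] by (simp add: Null_def)
      then show "x = 0" using pNull pW[OF x] by simp
    next
      assume "x = 0" then show "N' x = 0" using N'Null f.subspace_0[OF subNull] by simp
    qed
    show "N' (x + y) \<le> N' x + N' y" if "y \<in> W" for y using N'tri xC that WC by auto
  qed
  have N'min: "N' (x - y) = N' (y - x)" if "x \<in> Cau" "y \<in> Cau" for x y
    using N'sc[of "x - y" "-1"] f.subspace_diff[OF subCau that] by simp
  have N'tri3: "N' (x - z) \<le> N' (x - y) + N' (y - z)" if "x \<in> Cau" "y \<in> Cau" "z \<in> Cau" for x y z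
    using N'tri[of "x - y" "y - z"] f.subspace_diff[OF subCau] that by simp
  define d where "d = norm_dist W N'"
  have d_eq: "d x y = N' (x - y)" if "x \<in> W" "y \<in> W" for x y
    using that by (simp add: d_def norm_dist_def)
  interpret M: Metric_space W d
  proof
    fix x y z
    show "0 \<le> d x y" using N'nn f.subspace_diff[OF subCau] WC by (auto simp: d_def norm_dist_def)
    show "d x y = d y x" using N'min WC by (auto simp: d_def norm_dist_def)
    show "d x y = 0 \<longleftrightarrow> x = y" if "x \<in> W" "y \<in> W"
      using nsW f.subspace_diff[OF subW that] that by (simp add: normed_space_def d_eq)
    show "d x z \<le> d x y + d y z" if "x \<in> W" "y \<in> W" "z \<in> W"
      using N'tri3 that WC by (auto simp: d_eq)
  qed
  define \<iota> where "\<iota> v = p (\<lambda>_::nat. v)" for v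
  have const: "(\<lambda>_. v) \<in> Cau" if "v \<in> V" for v
    using that N0[OF V0] by (auto simp: Cau_def)
  have \<iota>W: "\<iota> v \<in> W" if "v \<in> V" for v using const[OF that] by (auto simp: \<iota>_def W_def)
  have \<iota>N: "N' (\<iota> v) = N v" if v: "v \<in> V" for v
  proof -
    have "N' (\<iota> v) = N' (\<lambda>_. v)" using N'p[OF const[OF v]] by (simp add: \<iota>_def)
    also have "\<dots> = N v" unfolding N'_def by simp
    finally show ?thesis .
  qed
  have \<iota>lin: "linear_map_on s S V \<iota>"
    unfolding linear_map_on_def
  proof (intro conjI ballI allI)
    fix u v :: 'v and c :: 'k
    have "(\<lambda>_::nat. u + v) = (\<lambda>_. u) + (\<lambda>_. v)" "(\<lambda>_::nat. s c v) = S c (\<lambda>_. v)"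
      by (auto simp: S_app plus_fun_apply)
    then show "\<iota> (u + v) = \<iota> u + \<iota> v" "\<iota> (s c v) = S c (\<iota> v)"
      by (simp_all add: \<iota>_def p.add p.scale)
  qed
  have near: "N' (p x - \<iota> v) = N' (x - (\<lambda>_. v))" if "x \<in> Cau" "v \<in> V" for x v
    using N'p[OF f.subspace_diff[OF subCau that(1) const[OF that(2)]]] by (simp add: \<iota>_def p.diff)
  have app: "\<exists>M. \<forall>m\<ge>M. N' (p x - \<iota> (x m)) \<le> \<epsilon>" if x: "x \<in> Cau" and "\<epsilon> > 0" for x \<epsilon>
  proof -
    obtain M where M: "\<And>m n. m \<ge> M \<Longrightarrow> n \<ge> M \<Longrightarrow> N (x m - x n) < \<epsilon>"
      using CauD[OF x] \<open>\<epsilon> > 0\<close> by blast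
    have "N' (p x - \<iota> (x m)) \<le> \<epsilon>" if "m \<ge> M" for m
    proof -
      have c: "x - (\<lambda>_. x m) \<in> Cau" using f.subspace_diff[OF subCau x const] CauV[OF x] by blast
      have "N' (x - (\<lambda>_. x m)) \<le> \<epsilon>"
        by (rule LIMSEQ_le_const2[OF lim[OF c]]) (use M that in \<open>auto simp: minus_apply intro!: exI[of _ M] less_imp_le\<close>)
      then show ?thesis using near[OF x] CauV[OF x] by simp
    qed
    then show ?thesis by blast
  qed
  have dense_app: "\<exists>v\<in>V. N' (w - \<iota> v) \<le> \<epsilon>" if w: "w \<in> W" and "\<epsilon> > 0" for w \<epsilon>
    using app[of w \<epsilon>] that pW[OF w] WC CauV by (metis order_refl subsetD)
  have dense: "M.mtopology closure_of (\<iota> ` V) = W"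
  proof (rule antisym)
    show "M.mtopology closure_of (\<iota> ` V) \<subseteq> W" using closure_of_subset_topspace by fastforce
    show "W \<subseteq> M.mtopology closure_of (\<iota> ` V)"
    proof
      fix w assume w: "w \<in> W"
      have "\<exists>y\<in>\<iota> ` V. y \<in> W \<and> d w y < r" if "r > 0" for r
      proof -
        obtain v where "v \<in> V" "N' (w - \<iota> v) \<le> r / 2" using dense_app[OF w, of "r / 2"] \<open>r > 0\<close> by auto
        then show ?thesis using \<iota>W w that by (intro bexI[of _ "\<iota> v"]) (auto simp: d_eq)
      qed
      then show "w \<in> M.mtopology closure_of (\<iota> ` V)"
        using w unfolding M.metric_closure_of by auto
    qed
  qed
  have complete: "M.mcomplete"
    unfolding M.mcomplete_def
  proof (intro allI impI)
    fix \<sigma> assume \<sigma>: "M.MCauchy \<sigma>"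
    then have \<sigma>W: "\<sigma> n \<in> W" for n by (auto simp: M.MCauchy_def)
    have "\<exists>v\<in>V. N' (\<sigma> n - \<iota> v) \<le> inverse (real (Suc n))" for n
      using dense_app[OF \<sigma>W] by simp
    then obtain x where xV: "\<And>n. x n \<in> V"
      and x: "\<And>n. N' (\<sigma> n - \<iota> (x n)) \<le> inverse (real (Suc n))" by metis
    have \<iota>C: "\<iota> (x n) \<in> Cau" and \<sigma>C: "\<sigma> n \<in> Cau" for n using \<iota>W xV WC \<sigma>W by auto
    have small: "\<exists>M. \<forall>n\<ge>M. inverse (real (Suc n)) < \<epsilon>" if "\<epsilon> > 0" for \<epsilon> :: real
      using that LIMSEQ_inverse_real_of_nat[THEN LIMSEQ_D, of \<epsilon>] by simp
    have xC: "x \<in> Cau"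
    proof -
      have "\<exists>M. \<forall>m\<ge>M. \<forall>n\<ge>M. N (x m - x n) < \<epsilon>" if "\<epsilon> > 0" for \<epsilon>
      proof -
        obtain M1 where M1: "\<And>n. n \<ge> M1 \<Longrightarrow> inverse (real (Suc n)) < \<epsilon> / 3"
          using small[of "\<epsilon> / 3"] \<open>\<epsilon> > 0\<close> by auto
        obtain M2 where M2: "\<And>m n. m \<ge> M2 \<Longrightarrow> n \<ge> M2 \<Longrightarrow> d (\<sigma> m) (\<sigma> n) < \<epsilon> / 3"
          using \<sigma> \<open>\<epsilon> > 0\<close> unfolding M.MCauchy_def by (meson divide_pos_pos zero_less_numeral)
        have "N (x m - x n) < \<epsilon>" if mn: "m \<ge> max M1 M2" "n \<ge> max M1 M2" for m n
        proof -
          have "\<iota> (x m + s (-1) (x n)) = \<iota> (x m) + S (-1) (\<iota> (x n))"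
            using \<iota>lin xV Vsc unfolding linear_map_on_def by metis
          then have "N (x m - x n) = N' (\<iota> (x m) - \<iota> (x n))"
            using \<iota>N[of "x m - x n"] Vdiff xV by simp
          also have "\<dots> \<le> N' (\<iota> (x m) - \<sigma> m) + (N' (\<sigma> m - \<sigma> n) + N' (\<sigma> n - \<iota> (x n)))"
            using N'tri3[of "\<iota> (x m)" "\<sigma> m" "\<iota> (x n)"] N'tri3[of "\<sigma> m" "\<sigma> n" "\<iota> (x n)"] \<iota>C \<sigma>C
            by simp
          also have "N' (\<iota> (x m) - \<sigma> m) \<le> inverse (real (Suc m))"
            using x N'min[OF \<iota>C \<sigma>C] by metis
          finally show ?thesis
            using x[of n] M1[of m] M1[of n] M2[of m n] mn d_eq[OF \<sigma>W \<sigma>W] by simp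
        qed
        then show ?thesis by blast
      qed
      then show ?thesis using xV by (simp add: Cau_def)
    qed
    have px: "p x \<in> W" using xC by (simp add: W_def)
    have "\<exists>M. \<forall>n\<ge>M. \<sigma> n \<in> W \<and> d (\<sigma> n) (p x) < \<epsilon>" if "\<epsilon> > 0" for \<epsilon>
    proof -
      obtain M1 where M1: "\<And>n. n \<ge> M1 \<Longrightarrow> inverse (real (Suc n)) < \<epsilon> / 2"
        using small[of "\<epsilon> / 2"] \<open>\<epsilon> > 0\<close> by auto
      obtain M2 where M2: "\<And>n. n \<ge> M2 \<Longrightarrow> N' (p x - \<iota> (x n)) \<le> \<epsilon> / 2"
        using app[OF xC, of "\<epsilon> / 2"] \<open>\<epsilon> > 0\<close> by auto
      have "d (\<sigma> n) (p x) < \<epsilon>" if "n \<ge> max M1 M2" for n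
      proof -
        have "N' (\<sigma> n - p x) \<le> N' (\<sigma> n - \<iota> (x n)) + N' (\<iota> (x n) - p x)"
          using N'tri3[OF \<sigma>C \<iota>C] px WC by auto
        also have "N' (\<iota> (x n) - p x) = N' (p x - \<iota> (x n))" using N'min[OF \<iota>C] px WC by auto
        finally show ?thesis using x[of n] M1[of n] M2[of n] that d_eq[OF \<sigma>W px] by simp
      qed
      then show ?thesis using \<sigma>W by blast
    qed
    then have "limitin M.mtopology \<sigma> (p x) sequentially"
      using px by (simp add: M.limit_metric_sequentially)
    then show "\<exists>x. limitin M.mtopology \<sigma> x sequentially" by blast
  qed
  have "is_completion s V N S W N' \<iota>"
    using NS nsW complete dense \<iota>W \<iota>lin \<iota>N
    by (auto simp: is_completion_def banach_space_def d_def)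
  then show ?thesis unfolding S_def by blast
qed

text \<open>
  Throughout, \<open>sE\<close> is the \<open>'k\<close>-scalar multiplication of the Banach space \<open>E\<close> (whose addition, norm
  and completeness come from the type class; on real scalars \<open>normed_space sE UNIV norm\<close> forces
  \<open>sE\<close> to agree with \<open>scaleR\<close>) and \<open>x0\<close> is the base point of \<open>X\<close>.
\<close>

abbreviation E_dual :: "('k::real_normed_field \<Rightarrow> 'e::banach \<Rightarrow> 'e) \<Rightarrow> ('e \<Rightarrow> 'k) set" where
  "E_dual sE \<equiv> dual_space sE UNIV norm"

definition Lip0 ::
    "('k::real_normed_field \<Rightarrow> 'e::banach \<Rightarrow> 'e) \<Rightarrow> 'x::metric_space \<Rightarrow> ('x \<Rightarrow> 'e \<Rightarrow> 'k) set" where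
  "Lip0 sE x0 =
     {f. range f \<subseteq> E_dual sE \<and> f x0 = 0 \<and>
         (\<exists>C\<ge>0. \<forall>x y. dual_norm UNIV norm (f x - f y) \<le> C * dist x y)}"

text \<open>
  \<open>elem_tensor sE x0 x y e\<close> is \<open>\<delta>\<^bsub>(x,y)\<^esub> \<boxtimes> e\<close>; it is set to \<open>0\<close> off \<open>Lip0\<close>, so that elements of
  \<open>X \<boxtimes> E\<close> are equal exactly when they agree on \<open>Lip0\<close>.
\<close>

definition elem_tensor ::
    "('k::real_normed_field \<Rightarrow> 'e::banach \<Rightarrow> 'e) \<Rightarrow> 'x::metric_space \<Rightarrow>
     'x \<Rightarrow> 'x \<Rightarrow> 'e \<Rightarrow> ('x \<Rightarrow> 'e \<Rightarrow> 'k) \<Rightarrow> 'k" where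
  "elem_tensor sE x0 x y e = (\<lambda>f. if f \<in> Lip0 sE x0 then (f x - f y) e else 0)"

definition lip_tensor ::
    "('k::real_normed_field \<Rightarrow> 'e::banach \<Rightarrow> 'e) \<Rightarrow> 'x::metric_space \<Rightarrow> (('x \<Rightarrow> 'e \<Rightarrow> 'k) \<Rightarrow> 'k) set" where
  "lip_tensor sE x0 = module.span (fun_scale (*)) {elem_tensor sE x0 x y e | x y e. True}"

definition lip_cross_norm ::
    "('k::real_normed_field \<Rightarrow> 'e::banach \<Rightarrow> 'e) \<Rightarrow> 'x::metric_space \<Rightarrow>
     ((('x \<Rightarrow> 'e \<Rightarrow> 'k) \<Rightarrow> 'k) \<Rightarrow> real) \<Rightarrow> bool" where
  "lip_cross_norm sE x0 \<alpha> \<longleftrightarrow>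
     normed_space (fun_scale (*)) (lip_tensor sE x0) \<alpha> \<and>
     (\<forall>x y e. \<alpha> (elem_tensor sE x0 x y e) = dist x y * norm e)"

definition alpha_bound ::
    "('k::real_normed_field \<Rightarrow> 'e::banach \<Rightarrow> 'e) \<Rightarrow> 'x::metric_space \<Rightarrow>
     ((('x \<Rightarrow> 'e \<Rightarrow> 'k) \<Rightarrow> 'k) \<Rightarrow> real) \<Rightarrow> ('x \<Rightarrow> 'e \<Rightarrow> 'k) \<Rightarrow> real \<Rightarrow> bool" where
  "alpha_bound sE x0 \<alpha> f C \<longleftrightarrow>
     (\<forall>n::nat. \<forall>x y e. norm (\<Sum>i<n. (f (x i) - f (y i)) (e i))
                        \<le> C * \<alpha> (\<Sum>i<n. elem_tensor sE x0 (x i) (y i) (e i)))"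

definition Lip_alpha ::
    "('k::real_normed_field \<Rightarrow> 'e::banach \<Rightarrow> 'e) \<Rightarrow> 'x::metric_space \<Rightarrow>
     ((('x \<Rightarrow> 'e \<Rightarrow> 'k) \<Rightarrow> 'k) \<Rightarrow> real) \<Rightarrow> ('x \<Rightarrow> 'e \<Rightarrow> 'k) set" where
  "Lip_alpha sE x0 \<alpha> =
     {f. range f \<subseteq> E_dual sE \<and> f x0 = 0 \<and> (\<exists>C\<ge>0. alpha_bound sE x0 \<alpha> f C)}"

definition Lip_alpha_norm ::
    "('k::real_normed_field \<Rightarrow> 'e::banach \<Rightarrow> 'e) \<Rightarrow> 'x::metric_space \<Rightarrow>
     ((('x \<Rightarrow> 'e \<Rightarrow> 'k) \<Rightarrow> 'k) \<Rightarrow> real) \<Rightarrow> ('x \<Rightarrow> 'e \<Rightarrow> 'k) \<Rightarrow> real" where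
  "Lip_alpha_norm sE x0 \<alpha> f = Inf {C. 0 \<le> C \<and> alpha_bound sE x0 \<alpha> f C}"

text \<open>
  \<open>\<phi>\<close> is a bounded functional on the completion \<open>(W, N')\<close> of \<open>X \<boxtimes>\<^sub>\<alpha> E\<close>
  whose restriction along \<open>\<iota>\<close> is given by the formula that defines \<open>\<Lambda>(f)\<close>.
\<close>

definition Lambda_spec ::
    "('k::real_normed_field \<Rightarrow> 'e::banach \<Rightarrow> 'e) \<Rightarrow> 'x::metric_space \<Rightarrow>
     ('k \<Rightarrow> 'w::ab_group_add \<Rightarrow> 'w) \<Rightarrow> 'w set \<Rightarrow> ('w \<Rightarrow> real) \<Rightarrow> ((('x \<Rightarrow> 'e \<Rightarrow> 'k) \<Rightarrow> 'k) \<Rightarrow> 'w) \<Rightarrow>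
     ('x \<Rightarrow> 'e \<Rightarrow> 'k) \<Rightarrow> ('w \<Rightarrow> 'k) \<Rightarrow> bool" where
  "Lambda_spec sE x0 s' W N' \<iota> f \<phi> \<longleftrightarrow>
     \<phi> \<in> dual_space s' W N' \<and>
     (\<forall>n::nat. \<forall>x y e. \<phi> (\<iota> (\<Sum>i<n. elem_tensor sE x0 (x i) (y i) (e i)))
                        = (\<Sum>i<n. (f (x i) - f (y i)) (e i)))"

definition Lambda ::
    "('k::real_normed_field \<Rightarrow> 'e::banach \<Rightarrow> 'e) \<Rightarrow> 'x::metric_space \<Rightarrow>
     ('k \<Rightarrow> 'w::ab_group_add \<Rightarrow> 'w) \<Rightarrow> 'w set \<Rightarrow> ('w \<Rightarrow> real) \<Rightarrow> ((('x \<Rightarrow> 'e \<Rightarrow> 'k) \<Rightarrow> 'k) \<Rightarrow> 'w) \<Rightarrow>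
     ('x \<Rightarrow> 'e \<Rightarrow> 'k) \<Rightarrow> 'w \<Rightarrow> 'k" where
  "Lambda sE x0 s' W N' \<iota> f = (THE \<phi>. Lambda_spec sE x0 s' W N' \<iota> f \<phi>)"

end

theory Submission
  imports Defs
begin

text \<open>
  A functional \<open>\<phi>\<close> on the completion of \<open>X \<boxtimes>\<^sub>\<alpha> E\<close> is determined by its values on the elementary
  tensors, and \<open>\<delta>\<^bsub>(x,y)\<^esub> \<boxtimes> e\<close> is the difference of \<open>\<delta>\<^bsub>(x,x0)\<^esub> \<boxtimes> e\<close> and \<open>\<delta>\<^bsub>(y,x0)\<^esub> \<boxtimes> e\<close>.
  So \<open>\<phi>\<close> carries the same information as the map \<open>f\<close> with \<open>f x e = \<phi> (\<delta>\<^bsub>(x,x0)\<^esub> \<boxtimes> e)\<close>; this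
  candidate for the inverse of \<open>\<Lambda>\<close> is called \<open>operator_of\<close> below.  The cross-norm identity
  \<open>\<alpha> (\<delta>\<^bsub>(x,x0)\<^esub> \<boxtimes> e) = d(x,x0) \<parallel>e\<parallel>\<close> makes each \<open>f x\<close> a bounded functional on \<open>E\<close>.

  In the other direction, an inequality \<open>\<bar>\<Sum>\<langle>f(x\<^sub>i) - f(y\<^sub>i), e\<^sub>i\<rangle>\<bar> \<le> C \<alpha>(\<Sum>\<delta>\<^bsub>(x\<^sub>i,y\<^sub>i)\<^esub> \<boxtimes> e\<^sub>i)\<close>
  over all representations already contains the independence of the representation: two
  representations of one tensor differ by a representation of \<open>0\<close>, where \<open>\<alpha>\<close> vanishes.  Hence \<open>f\<close>
  induces a bounded functional on \<open>X \<boxtimes>\<^sub>\<alpha> E\<close> (\<open>functional_of_operator\<close>), which extends to the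
  completion by continuity (\<open>dual_extends\<close>), uniquely by density (\<open>dual_eq_if_eq_on_range\<close>).

  The constants \<open>C\<close> admissible for \<open>f\<close> are exactly the constants admissible for \<open>\<Lambda>(f)\<close> on the
  completion (\<open>alpha_bound_iff_functional_bound\<close>), and the least of these is the dual norm; this
  gives the isometry.  Linearity of \<open>\<Lambda>\<close> and the normed space structure of the \<open>\<alpha>\<close>-Lipschitz
  operators are read off from the inverse map, which is visibly linear.
\<close>

section \<open>Normed spaces on a carrier and their duals\<close>

locale normed_carrier =
  fixes s :: "'k::real_normed_field \<Rightarrow> 'v::ab_group_add \<Rightarrow> 'v" and V :: "'v set" and N :: "'v \<Rightarrow> real"
  assumes normed: "normed_space s V N"
begin

sublocale vector_space s
  using normed by (simp add: normed_space_def)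

lemma subspace_carrier: "subspace V"
  using normed by (simp add: normed_space_def)

lemmas zero_mem = subspace_0[OF subspace_carrier]
  and add_mem = subspace_add[OF subspace_carrier]
  and diff_mem = subspace_diff[OF subspace_carrier]
  and scale_mem = subspace_scale[OF subspace_carrier]

lemma N_nonneg: "v \<in> V \<Longrightarrow> 0 \<le> N v"
  and N_eq_0: "v \<in> V \<Longrightarrow> N v = 0 \<longleftrightarrow> v = 0"
  and N_triangle: "u \<in> V \<Longrightarrow> v \<in> V \<Longrightarrow> N (u + v) \<le> N u + N v"
  and N_scale: "v \<in> V \<Longrightarrow> N (s c v) = norm c * N v"
  using normed by (auto simp: normed_space_def)

lemma N_zero: "N 0 = 0"
  using N_eq_0[OF zero_mem] by simp

lemma N_diff_commute:
  assumes "u \<in> V" "v \<in> V"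
  shows "N (u - v) = N (v - u)"
  using N_scale[of "u - v" "-1"] diff_mem[OF assms] by simp

lemma N_diff_triangle:
  assumes "u \<in> V" "v \<in> V" "w \<in> V"
  shows "N (u - w) \<le> N (u - v) + N (v - w)"
  using N_triangle[of "u - v" "v - w"] diff_mem assms by simp

lemma Metric_space_norm_dist: "Metric_space V (norm_dist V N)"
proof
  show "0 \<le> norm_dist V N x y" for x y
    by (simp add: norm_dist_def N_nonneg diff_mem)
  show "norm_dist V N x y = norm_dist V N y x" for x y
    by (simp add: norm_dist_def N_diff_commute)
  show "norm_dist V N x y = 0 \<longleftrightarrow> x = y" if "x \<in> V" "y \<in> V" for x y
    using that N_eq_0[OF diff_mem[OF that]] by (simp add: norm_dist_def)
  show "norm_dist V N x z \<le> norm_dist V N x y + norm_dist V N y z"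
    if "x \<in> V" "y \<in> V" "z \<in> V" for x y z
    using that N_diff_triangle by (simp add: norm_dist_def)
qed

lemma dual_add: "\<phi> \<in> dual_space s V N \<Longrightarrow> u \<in> V \<Longrightarrow> v \<in> V \<Longrightarrow> \<phi> (u + v) = \<phi> u + \<phi> v"
  and dual_scale: "\<phi> \<in> dual_space s V N \<Longrightarrow> v \<in> V \<Longrightarrow> \<phi> (s c v) = c * \<phi> v"
  and dual_outside: "\<phi> \<in> dual_space s V N \<Longrightarrow> w \<notin> V \<Longrightarrow> \<phi> w = 0"
  by (auto simp: dual_space_def linear_map_on_def)

lemma dual_zero: "\<phi> \<in> dual_space s V N \<Longrightarrow> \<phi> 0 = 0"
  using dual_scale[of \<phi> 0 0] zero_mem by simp

lemma dual_diff:
  assumes "\<phi> \<in> dual_space s V N" "u \<in> V" "v \<in> V"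
  shows "\<phi> (u - v) = \<phi> u - \<phi> v"
  using dual_add[OF assms(1), of "u - v" v] diff_mem assms by simp

lemma dual_eqI:
  assumes "\<phi> \<in> dual_space s V N" "\<psi> \<in> dual_space s V N" "\<And>v. v \<in> V \<Longrightarrow> \<phi> v = \<psi> v"
  shows "\<phi> = \<psi>"
  using assms dual_outside by (metis ext)

lemma bdd_above_unit_ball_values:
  assumes "\<phi> \<in> dual_space s V N"
  shows "bdd_above ((\<lambda>v. norm (\<phi> v)) ` {v \<in> V. N v \<le> 1})"
proof -
  obtain C where C: "\<And>v. v \<in> V \<Longrightarrow> norm (\<phi> v) \<le> C * N v"
    using assms by (auto simp: dual_space_def)
  have "norm (\<phi> v) \<le> \<bar>C\<bar>" if "v \<in> V" "N v \<le> 1" for v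
  proof -
    have "C * N v \<le> \<bar>C\<bar> * 1"
      using that N_nonneg by (intro mult_mono) auto
    then show ?thesis using C[of v] that by simp
  qed
  then show ?thesis
    by (intro bdd_aboveI2) auto
qed

lemma norm_le_dual_norm:
  assumes \<phi>: "\<phi> \<in> dual_space s V N" and v: "v \<in> V"
  shows "norm (\<phi> v) \<le> dual_norm V N \<phi> * N v"
proof (cases "v = 0")
  case True
  then show ?thesis by (simp add: dual_zero[OF \<phi>] N_zero)
next
  case False
  then have pos: "N v > 0"
    using N_eq_0[OF v] N_nonneg[OF v] by simp
  \<comment> \<open>The real factor that normalizes \<open>v\<close> has to be read as a scalar of \<open>'k\<close>.\<close>
  define c :: 'k where "c = of_real (inverse (N v))"
  have nc: "norm c = inverse (N v)"
    using pos by (simp add: c_def norm_inverse)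
  have "norm (\<phi> (s c v)) \<le> dual_norm V N \<phi>"
    unfolding dual_norm_def using pos v
    by (intro cSUP_upper[OF _ bdd_above_unit_ball_values[OF \<phi>]]) (auto simp: N_scale scale_mem nc)
  then show ?thesis
    using pos by (simp add: dual_scale[OF \<phi> v] norm_mult nc field_simps)
qed

lemma dual_norm_le:
  assumes "0 \<le> C" and bound: "\<And>v. v \<in> V \<Longrightarrow> norm (\<phi> v) \<le> C * N v"
  shows "dual_norm V N \<phi> \<le> C"
  unfolding dual_norm_def
proof (rule cSUP_least)
  show "{v \<in> V. N v \<le> 1} \<noteq> {}"
    using zero_mem N_zero by auto
  fix v assume "v \<in> {v \<in> V. N v \<le> 1}"
  then show "norm (\<phi> v) \<le> C"
    using bound[of v] mult_left_mono[of "N v" 1 C] \<open>0 \<le> C\<close> by auto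
qed

lemma dual_norm_nonneg:
  assumes "\<phi> \<in> dual_space s V N"
  shows "0 \<le> dual_norm V N \<phi>"
proof -
  have "norm (\<phi> 0) \<le> dual_norm V N \<phi>"
    unfolding dual_norm_def
    by (intro cSUP_upper[OF _ bdd_above_unit_ball_values[OF assms]]) (auto simp: zero_mem N_zero)
  then show ?thesis using norm_ge_zero order_trans by blast
qed

lemma dual_spaceI:
  assumes "\<And>u v. u \<in> V \<Longrightarrow> v \<in> V \<Longrightarrow> \<phi> (u + v) = \<phi> u + \<phi> v"
    and "\<And>c v. v \<in> V \<Longrightarrow> \<phi> (s c v) = c * \<phi> v"
    and "\<And>v. v \<in> V \<Longrightarrow> norm (\<phi> v) \<le> C * N v"
    and "\<And>v. v \<notin> V \<Longrightarrow> \<phi> v = 0"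
  shows "\<phi> \<in> dual_space s V N"
  unfolding dual_space_def linear_map_on_def using assms by blast

lemma dual_norm_add_bound:
  assumes "\<phi> \<in> dual_space s V N" "\<psi> \<in> dual_space s V N" "v \<in> V"
  shows "norm ((\<phi> + \<psi>) v) \<le> (dual_norm V N \<phi> + dual_norm V N \<psi>) * N v"
  using norm_triangle_ineq[of "\<phi> v" "\<psi> v"] norm_le_dual_norm[OF assms(1,3)]
    norm_le_dual_norm[OF assms(2,3)] by (simp add: algebra_simps)

lemma dual_norm_scale_bound:
  assumes "\<phi> \<in> dual_space s V N" "v \<in> V"
  shows "norm (fun_scale (*) c \<phi> v) \<le> (norm c * dual_norm V N \<phi>) * N v"
  using mult_left_mono[OF norm_le_dual_norm[OF assms], of "norm c"]
  by (simp add: fun_scale_def norm_mult mult.assoc)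

lemma dual_add_mem:
  assumes "\<phi> \<in> dual_space s V N" "\<psi> \<in> dual_space s V N"
  shows "\<phi> + \<psi> \<in> dual_space s V N"
  by (rule dual_spaceI[OF _ _ dual_norm_add_bound[OF assms]])
    (auto simp: dual_add[OF assms(1)] dual_add[OF assms(2)] dual_scale[OF assms(1)]
      dual_scale[OF assms(2)] dual_outside[OF assms(1)] dual_outside[OF assms(2)] algebra_simps)

lemma dual_scale_mem:
  assumes "\<phi> \<in> dual_space s V N"
  shows "fun_scale (*) c \<phi> \<in> dual_space s V N"
  by (rule dual_spaceI[OF _ _ dual_norm_scale_bound[OF assms]])
    (auto simp: fun_scale_def dual_add[OF assms(1)] dual_scale[OF assms(1)] dual_outside[OF assms(1)]
      algebra_simps)

lemma dual_norm_scale: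
  assumes "\<phi> \<in> dual_space s V N"
  shows "dual_norm V N (fun_scale (*) c \<phi>) = norm c * dual_norm V N \<phi>"
proof -
  have le: "dual_norm V N (fun_scale (*) c \<psi>) \<le> norm c * dual_norm V N \<psi>"
    if "\<psi> \<in> dual_space s V N" for c \<psi>
    using that by (intro dual_norm_le dual_norm_scale_bound mult_nonneg_nonneg dual_norm_nonneg) auto
  show ?thesis
  proof (cases "c = 0")
    case True
    then show ?thesis
      using le[OF assms, of c] dual_norm_nonneg[OF dual_scale_mem[OF assms, of c]] by simp
  next
    case False
    then have "fun_scale (*) (inverse c) (fun_scale (*) c \<phi>) = \<phi>"
      by (simp add: fun_scale_def fun_eq_iff)
    then have "dual_norm V N \<phi> \<le> norm (inverse c) * dual_norm V N (fun_scale (*) c \<phi>)"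
      using le[OF dual_scale_mem[OF assms], of "inverse c" c] by simp
    then have "norm c * dual_norm V N \<phi> \<le> dual_norm V N (fun_scale (*) c \<phi>)"
      using False by (simp add: norm_divide field_simps)
    then show ?thesis using le[OF assms, of c] by simp
  qed
qed

lemma normed_space_dual: "normed_space (fun_scale (*)) (dual_space s V N) (dual_norm V N)"
proof -
  interpret D: vector_space "fun_scale (*) :: 'k \<Rightarrow> ('v \<Rightarrow> 'k) \<Rightarrow> _"
    by (rule vector_space_fun_scale) (rule vector_space_over_itself.vector_space_axioms)
  have zero: "0 \<in> dual_space s V N"
    by (rule dual_spaceI[of _ 0]) auto
  have "D.subspace (dual_space s V N)"
    by (rule D.subspaceI) (auto intro: zero dual_add_mem dual_scale_mem)
  moreover have "dual_norm V N \<phi> = 0 \<longleftrightarrow> \<phi> = 0" if \<phi>: "\<phi> \<in> dual_space s V N" for \<phi>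
  proof
    assume "dual_norm V N \<phi> = 0"
    then show "\<phi> = 0"
      using norm_le_dual_norm[OF \<phi>] by (intro dual_eqI[OF \<phi> zero]) auto
  next
    assume "\<phi> = 0"
    then show "dual_norm V N \<phi> = 0"
      using dual_norm_le[of 0 \<phi>] dual_norm_nonneg[OF \<phi>] by simp
  qed
  moreover have "dual_norm V N (\<phi> + \<psi>) \<le> dual_norm V N \<phi> + dual_norm V N \<psi>"
    if "\<phi> \<in> dual_space s V N" "\<psi> \<in> dual_space s V N" for \<phi> \<psi>
    using that by (intro dual_norm_le dual_norm_add_bound) (auto intro!: add_nonneg_nonneg dual_norm_nonneg)
  ultimately show ?thesis
    unfolding normed_space_def using D.vector_space_axioms dual_norm_nonneg dual_norm_scale by blast
qed

lemma Inf_bounds_eq_dual_norm: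
  assumes "\<phi> \<in> dual_space s V N"
  shows "Inf {C. 0 \<le> C \<and> (\<forall>v\<in>V. norm (\<phi> v) \<le> C * N v)} = dual_norm V N \<phi>"
  by (intro cInf_eq_minimum)
    (use assms in \<open>auto intro: dual_norm_nonneg norm_le_dual_norm dual_norm_le\<close>)

end

section \<open>Functionals on a completion\<close>

locale completed =
  fixes s :: "'k::{real_normed_field, banach} \<Rightarrow> 'v::ab_group_add \<Rightarrow> 'v" and V :: "'v set"
    and N :: "'v \<Rightarrow> real" and s' :: "'k \<Rightarrow> 'w::ab_group_add \<Rightarrow> 'w" and W :: "'w set"
    and N' :: "'w \<Rightarrow> real" and \<iota> :: "'v \<Rightarrow> 'w"
  assumes completion: "is_completion s V N s' W N' \<iota>"
begin

sublocale V: normed_carrier s V N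
  using completion by unfold_locales (simp add: is_completion_def)

sublocale W: normed_carrier s' W N'
  using completion by unfold_locales (simp add: is_completion_def banach_space_def)

lemma \<iota>_mem: "v \<in> V \<Longrightarrow> \<iota> v \<in> W"
  and \<iota>_add: "u \<in> V \<Longrightarrow> v \<in> V \<Longrightarrow> \<iota> (u + v) = \<iota> u + \<iota> v"
  and \<iota>_scale: "v \<in> V \<Longrightarrow> \<iota> (s c v) = s' c (\<iota> v)"
  and \<iota>_norm: "v \<in> V \<Longrightarrow> N' (\<iota> v) = N v"
  using completion by (auto simp: is_completion_def linear_map_on_def)

lemma \<iota>_zero: "\<iota> 0 = 0"
  using \<iota>_scale[OF V.zero_mem, of 0] by simp

lemma \<iota>_diff: "u \<in> V \<Longrightarrow> v \<in> V \<Longrightarrow> \<iota> (u - v) = \<iota> u - \<iota> v"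
  using \<iota>_add[of "u - v" v] V.diff_mem by simp

lemma dense:
  assumes "w \<in> W" "\<epsilon> > 0"
  obtains v where "v \<in> V" "N' (w - \<iota> v) < \<epsilon>"
proof -
  interpret M: Metric_space W "norm_dist W N'"
    by (rule W.Metric_space_norm_dist)
  have "w \<in> M.mtopology closure_of (\<iota> ` V)"
    using completion assms by (simp add: is_completion_def)
  then obtain v where "v \<in> V" "norm_dist W N' w (\<iota> v) < \<epsilon>"
    using assms by (force simp: M.metric_closure_of)
  then show ?thesis
    using that assms \<iota>_mem by (auto simp: norm_dist_def)
qed

text \<open>
  Approximate \<open>w\<close> by \<open>\<iota> v\<close>.  The error is controlled by the finite dual norm of \<open>\<phi>\<close>, so the bound
  survives in the limit with the same constant \<open>C\<close>, however large that dual norm is.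
\<close>

lemma bound_extends:
  assumes \<phi>: "\<phi> \<in> dual_space s' W N'" and "0 \<le> C"
    and bound: "\<And>v. v \<in> V \<Longrightarrow> norm (\<phi> (\<iota> v)) \<le> C * N v" and w: "w \<in> W"
  shows "norm (\<phi> w) \<le> C * N' w"
proof (rule field_le_epsilon)
  fix e :: real assume "e > 0"
  define D where "D = dual_norm W N' \<phi>"
  have D: "0 \<le> D" using W.dual_norm_nonneg[OF \<phi>] by (simp add: D_def)
  have pos: "D + C + 1 > 0" using D \<open>0 \<le> C\<close> by simp
  obtain v where v: "v \<in> V" "N' (w - \<iota> v) < e / (D + C + 1)"
    using dense[OF w divide_pos_pos[OF \<open>e > 0\<close> pos]] by blast
  have iv: "\<iota> v \<in> W" using \<iota>_mem v by simp
  have dW: "w - \<iota> v \<in> W" using W.diff_mem w iv by simp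
  have "norm (\<phi> w) \<le> norm (\<phi> (w - \<iota> v)) + norm (\<phi> (\<iota> v))"
    using norm_triangle_ineq[of "\<phi> (w - \<iota> v)" "\<phi> (\<iota> v)"] W.dual_diff[OF \<phi> w iv] by simp
  also have "\<dots> \<le> D * N' (w - \<iota> v) + C * N' (\<iota> v)"
    using W.norm_le_dual_norm[OF \<phi> dW] bound[OF v(1)] \<iota>_norm[OF v(1)] by (simp add: D_def)
  also have "C * N' (\<iota> v) \<le> C * (N' w + N' (w - \<iota> v))"
    using W.N_diff_triangle[OF iv w W.zero_mem] W.N_diff_commute[OF w iv] \<open>0 \<le> C\<close>
    by (intro mult_left_mono) auto
  finally have "norm (\<phi> w) \<le> C * N' w + (D + C) * N' (w - \<iota> v)"
    by (simp add: algebra_simps)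
  also have "(D + C) * N' (w - \<iota> v) \<le> (D + C + 1) * (e / (D + C + 1))"
    using v D \<open>0 \<le> C\<close> W.N_nonneg[OF dW] pos by (intro mult_mono) auto
  also have "\<dots> = e" using pos by simp
  finally show "norm (\<phi> w) \<le> C * N' w + e" by simp
qed

text \<open>The difference of the two functionals satisfies the bound \<open>C = 0\<close> on the dense subspace.\<close>

lemma dual_eq_if_eq_on_range:
  assumes \<phi>: "\<phi> \<in> dual_space s' W N'" and \<psi>: "\<psi> \<in> dual_space s' W N'"
    and eq: "\<And>v. v \<in> V \<Longrightarrow> \<phi> (\<iota> v) = \<psi> (\<iota> v)"
  shows "\<phi> = \<psi>"
proof (rule W.dual_eqI[OF \<phi> \<psi>])
  fix w assume w: "w \<in> W"
  have D: "\<phi> + fun_scale (*) (-1) \<psi> \<in> dual_space s' W N'"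
    by (intro W.dual_add_mem W.dual_scale_mem \<phi> \<psi>)
  have "norm ((\<phi> + fun_scale (*) (-1) \<psi>) w) \<le> 0 * N' w"
    by (rule bound_extends[OF D _ _ w]) (simp_all add: fun_scale_def eq)
  then show "\<phi> w = \<psi> w"
    by (simp add: fun_scale_def)
qed

text \<open>
  The value at \<open>w\<close> of the extension of \<open>\<phi>\<close> by continuity.  Instead of describing it as the limit of
  \<open>\<phi>\<close> along some sequence, the inequality below pins it down by its distance to all values of \<open>\<phi>\<close>
  at once.  This form does not refer to a choice of sequence, so additivity and homogeneity of the
  extension can be checked by estimates.  The limit exists because \<open>'k\<close> is complete.
\<close>

lemma approximate_value_exists:
  assumes \<phi>: "\<phi> \<in> dual_space s V N" and w: "w \<in> W"
  shows "\<exists>l. \<forall>v\<in>V. norm (l - \<phi> v) \<le> dual_norm V N \<phi> * N' (w - \<iota> v)"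
proof -
  define D where "D = dual_norm V N \<phi>"
  have D: "0 \<le> D" using V.dual_norm_nonneg[OF \<phi>] by (simp add: D_def)
  have near: "norm (\<phi> u - \<phi> v) \<le> D * (N' (w - \<iota> u) + N' (w - \<iota> v))" if "u \<in> V" "v \<in> V" for u v
  proof -
    have "norm (\<phi> u - \<phi> v) \<le> D * N' (\<iota> u - \<iota> v)"
      using V.norm_le_dual_norm[OF \<phi> V.diff_mem[OF that]] that
      by (simp add: D_def V.dual_diff[OF \<phi>] \<iota>_norm[OF V.diff_mem[OF that], symmetric]
          \<iota>_diff[OF that, symmetric])
    also have "N' (\<iota> u - \<iota> v) \<le> N' (w - \<iota> u) + N' (w - \<iota> v)"
      using W.N_diff_triangle[of "\<iota> u" w "\<iota> v"] W.N_diff_commute[of w "\<iota> u"] w \<iota>_mem that by simp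
    finally show ?thesis using D by (simp add: mult_left_mono)
  qed
  have "\<exists>v\<in>V. N' (w - \<iota> v) < inverse (real (Suc n))" for n
    using dense[OF w, of "inverse (real (Suc n))"] by auto
  then obtain v where v: "\<And>n. v n \<in> V" and close: "\<And>n. N' (w - \<iota> (v n)) < inverse (real (Suc n))"
    by metis
  have lim0: "(\<lambda>n. N' (w - \<iota> (v n))) \<longlonglongrightarrow> 0"
  proof (rule tendsto_sandwich[OF _ _ tendsto_const LIMSEQ_inverse_real_of_nat])
    show "\<forall>\<^sub>F n in sequentially. 0 \<le> N' (w - \<iota> (v n))"
      using W.N_nonneg W.diff_mem w \<iota>_mem v by simp
    show "\<forall>\<^sub>F n in sequentially. N' (w - \<iota> (v n)) \<le> inverse (real (Suc n))"
      by (intro always_eventually allI less_imp_le close)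
  qed
  have "Cauchy (\<lambda>n. \<phi> (v n))"
  proof (rule CauchyI)
    fix e :: real assume "e > 0"
    then have "e / (2 * (D + 1)) > 0" using D by simp
    then obtain M where M: "\<And>n. n \<ge> M \<Longrightarrow> N' (w - \<iota> (v n)) < e / (2 * (D + 1))"
      using LIMSEQ_D[OF lim0, of "e / (2 * (D + 1))"] by (metis abs_less_iff diff_zero real_norm_def)
    have "norm (\<phi> (v m) - \<phi> (v n)) < e" if "m \<ge> M" "n \<ge> M" for m n
    proof -
      have "norm (\<phi> (v m) - \<phi> (v n)) \<le> (D + 1) * (N' (w - \<iota> (v m)) + N' (w - \<iota> (v n)))"
        using near[OF v v, of m n] W.N_nonneg[OF W.diff_mem[OF w \<iota>_mem[OF v]], of m]
          W.N_nonneg[OF W.diff_mem[OF w \<iota>_mem[OF v]], of n] by (simp add: algebra_simps)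
      also have "\<dots> < (D + 1) * (e / (2 * (D + 1)) + e / (2 * (D + 1)))"
        using M[OF that(1)] M[OF that(2)] D by (intro mult_strict_left_mono add_strict_mono) auto
      also have "\<dots> = e"
      proof -
        have "K * (e / (2 * K) + e / (2 * K)) = e" if "K > 0" for K :: real
          using that by (simp add: field_simps)
        from this[of "D + 1"] show ?thesis using D by linarith
      qed
      finally show ?thesis .
    qed
    then show "\<exists>M. \<forall>m\<ge>M. \<forall>n\<ge>M. norm (\<phi> (v m) - \<phi> (v n)) < e" by blast
  qed
  then obtain l where l: "(\<lambda>n. \<phi> (v n)) \<longlonglongrightarrow> l"
    using Cauchy_convergent convergent_def by blast
  have "norm (l - \<phi> u) \<le> D * N' (w - \<iota> u)" if u: "u \<in> V" for u
  proof (rule LIMSEQ_le)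
    show "(\<lambda>n. norm (\<phi> (v n) - \<phi> u)) \<longlonglongrightarrow> norm (l - \<phi> u)"
      by (intro tendsto_intros l)
    have "(\<lambda>n. D * (N' (w - \<iota> (v n)) + N' (w - \<iota> u))) \<longlonglongrightarrow> D * (0 + N' (w - \<iota> u))"
      by (intro tendsto_intros lim0)
    then show "(\<lambda>n. D * (N' (w - \<iota> (v n)) + N' (w - \<iota> u))) \<longlonglongrightarrow> D * N' (w - \<iota> u)" by simp
    show "\<exists>M. \<forall>n\<ge>M. norm (\<phi> (v n) - \<phi> u) \<le> D * (N' (w - \<iota> (v n)) + N' (w - \<iota> u))"
      using near v u by blast
  qed
  then show ?thesis unfolding D_def by blast
qed

lemma dual_extends:
  assumes \<phi>: "\<phi> \<in> dual_space s V N"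
  obtains \<psi> where "\<psi> \<in> dual_space s' W N'" "\<And>v. v \<in> V \<Longrightarrow> \<psi> (\<iota> v) = \<phi> v"
proof -
  define D where "D = dual_norm V N \<phi>"
  have D: "0 \<le> D" using V.dual_norm_nonneg[OF \<phi>] by (simp add: D_def)
  have "\<exists>\<psi>. \<forall>w\<in>W. \<forall>v\<in>V. norm (\<psi> w - \<phi> v) \<le> D * N' (w - \<iota> v)"
    unfolding D_def using approximate_value_exists[OF \<phi>] by (intro bchoice) blast
  then obtain \<psi>0 where \<psi>0: "\<And>w v. w \<in> W \<Longrightarrow> v \<in> V \<Longrightarrow> norm (\<psi>0 w - \<phi> v) \<le> D * N' (w - \<iota> v)"
    by blast
  define \<psi> where "\<psi> w = (if w \<in> W then \<psi>0 w else 0)" for w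
  have app: "norm (\<psi> w - \<phi> v) \<le> D * N' (w - \<iota> v)" if "w \<in> W" "v \<in> V" for w v
    using \<psi>0 that by (simp add: \<psi>_def)
  have app_e: "\<exists>v\<in>V. N' (w - \<iota> v) \<le> e \<and> norm (\<psi> w - \<phi> v) \<le> D * e" if "w \<in> W" "e > 0" for w e
  proof -
    obtain v where v: "v \<in> V" "N' (w - \<iota> v) < e" using dense[OF \<open>w \<in> W\<close> \<open>e > 0\<close>] by blast
    then show ?thesis
      using app[OF that(1) v(1)] mult_left_mono[of "N' (w - \<iota> v)" e D] D by (intro bexI[of _ v]) auto
  qed
  have eqI: "a = b" if K: "0 \<le> K" and small: "\<And>e. e > 0 \<Longrightarrow> norm (a - b) \<le> K * e" for a b :: 'k and K :: real
  proof -
    have "norm (a - b) \<le> 0 + e" if "e > 0" for e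
    proof -
      have "norm (a - b) \<le> K * (e / (K + 1))"
        using K that by (intro small divide_pos_pos) auto
      also have "\<dots> \<le> e" using K that by (simp add: field_simps)
      finally show ?thesis by simp
    qed
    then show ?thesis using field_le_epsilon[of "norm (a - b)" 0] by simp
  qed
  have ext: "\<psi> (\<iota> v) = \<phi> v" if "v \<in> V" for v
    using app[OF \<iota>_mem[OF that] that] by (simp add: W.N_zero)
  have add: "\<psi> (w + z) = \<psi> w + \<psi> z" if w: "w \<in> W" and z: "z \<in> W" for w z
  proof (rule eqI[of "4 * D"])
    fix e :: real assume "e > 0"
    obtain u v where u: "u \<in> V" "N' (w - \<iota> u) \<le> e" "norm (\<psi> w - \<phi> u) \<le> D * e"
      and v: "v \<in> V" "N' (z - \<iota> v) \<le> e" "norm (\<psi> z - \<phi> v) \<le> D * e"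
      using app_e[OF w \<open>e > 0\<close>] app_e[OF z \<open>e > 0\<close>] by blast
    have "w + z - \<iota> (u + v) = (w - \<iota> u) + (z - \<iota> v)" by (simp add: \<iota>_add u v)
    then have N'_eq: "N' (w + z - \<iota> (u + v)) = N' ((w - \<iota> u) + (z - \<iota> v))" by (rule arg_cong)
    have "N' (w + z - \<iota> (u + v)) \<le> e + e"
      unfolding N'_eq
      using W.N_triangle[OF W.diff_mem[OF w \<iota>_mem[OF u(1)]] W.diff_mem[OF z \<iota>_mem[OF v(1)]]] u v by simp
    then have "norm (\<psi> (w + z) - \<phi> (u + v)) \<le> D * (e + e)"
      by (rule order_trans[OF app[OF W.add_mem[OF w z] V.add_mem[OF u(1) v(1)]] mult_left_mono[OF _ D]])
    moreover have "\<psi> (w + z) - (\<psi> w + \<psi> z)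
        = (\<psi> (w + z) - \<phi> (u + v)) - ((\<psi> w - \<phi> u) + (\<psi> z - \<phi> v))"
      by (simp add: V.dual_add[OF \<phi> u(1) v(1)])
    ultimately show "norm (\<psi> (w + z) - (\<psi> w + \<psi> z)) \<le> 4 * D * e"
      using u v norm_triangle_ineq4[of "\<psi> (w + z) - \<phi> (u + v)" "(\<psi> w - \<phi> u) + (\<psi> z - \<phi> v)"]
        norm_triangle_ineq[of "\<psi> w - \<phi> u" "\<psi> z - \<phi> v"] by (simp add: algebra_simps)
  qed (use D in simp)
  have scale: "\<psi> (s' c w) = c * \<psi> w" if w: "w \<in> W" for c w
  proof (rule eqI[of "2 * norm c * D"])
    fix e :: real assume "e > 0"
    obtain v where v: "v \<in> V" "N' (w - \<iota> v) \<le> e" "norm (\<psi> w - \<phi> v) \<le> D * e"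
      using app_e[OF w \<open>e > 0\<close>] by blast
    have "s' c w - \<iota> (s c v) = s' c (w - \<iota> v)" by (simp add: \<iota>_scale v W.scale_right_diff_distrib)
    then have "N' (s' c w - \<iota> (s c v)) \<le> norm c * e"
      using v W.N_scale[of "w - \<iota> v" c] W.diff_mem w \<iota>_mem by (simp add: mult_left_mono)
    then have "norm (\<psi> (s' c w) - \<phi> (s c v)) \<le> D * (norm c * e)"
      by (rule order_trans[OF app[OF W.scale_mem[OF w] V.scale_mem[OF v(1)]] mult_left_mono[OF _ D]])
    moreover have split: "\<psi> (s' c w) - c * \<psi> w = (\<psi> (s' c w) - \<phi> (s c v)) - c * (\<psi> w - \<phi> v)"
      by (simp add: V.dual_scale[OF \<phi> v(1)] algebra_simps)
    moreover have "norm (c * (\<psi> w - \<phi> v)) \<le> norm c * (D * e)"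
      using v by (simp add: norm_mult mult_left_mono)
    ultimately have "norm (\<psi> (s' c w) - c * \<psi> w) \<le> D * (norm c * e) + norm c * (D * e)"
      unfolding split by (intro order_trans[OF norm_triangle_ineq4 add_mono])
    then show "norm (\<psi> (s' c w) - c * \<psi> w) \<le> 2 * norm c * D * e"
      by (simp add: mult_ac)
  qed (use D in simp)
  have "\<psi> \<in> dual_space s' W N'"
  proof (rule W.dual_spaceI[of _ D, OF add scale])
    show "norm (\<psi> w) \<le> D * N' w" if "w \<in> W" for w
      using app[OF that V.zero_mem] by (simp add: V.dual_zero[OF \<phi>] \<iota>_zero)
  qed (auto simp: \<psi>_def)
  then show ?thesis using ext that by blast
qed

end

section \<open>The Lipschitz tensor product\<close>

text \<open>
  A list of triples \<open>(x, y, e)\<close> stands for the formal sum of the \<open>\<delta>\<^bsub>(x,y)\<^esub> \<boxtimes> e\<close>.  Lists are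
  preferred to families indexed by \<open>{..<n}\<close> because concatenation is the addition of formal sums.
\<close>

definition tensor_of ::
    "('k::real_normed_field \<Rightarrow> 'e::banach \<Rightarrow> 'e) \<Rightarrow> 'x::metric_space \<Rightarrow>
     ('x \<times> 'x \<times> 'e) list \<Rightarrow> ('x \<Rightarrow> 'e \<Rightarrow> 'k) \<Rightarrow> 'k" where
  "tensor_of sE x0 ts = (\<Sum>(x, y, e)\<leftarrow>ts. elem_tensor sE x0 x y e)"

definition pairing ::
    "('x \<Rightarrow> 'e \<Rightarrow> 'k::real_normed_field) \<Rightarrow> ('x \<times> 'x \<times> 'e) list \<Rightarrow> 'k" where
  "pairing f ts = (\<Sum>(x, y, e)\<leftarrow>ts. (f x - f y) e)"

lemma tensor_of_simps [simp]:
  "tensor_of sE x0 [] = 0"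
  "tensor_of sE x0 ((x, y, e) # ts) = elem_tensor sE x0 x y e + tensor_of sE x0 ts"
  "tensor_of sE x0 (ts @ us) = tensor_of sE x0 ts + tensor_of sE x0 us"
  by (simp_all add: tensor_of_def)

lemma pairing_simps [simp]:
  "pairing f [] = 0"
  "pairing f ((x, y, e) # ts) = (f x - f y) e + pairing f ts"
  "pairing f (ts @ us) = pairing f ts + pairing f us"
  by (simp_all add: pairing_def)

lemma all_finite_families_iff_all_lists:
  "(\<forall>n::nat. \<forall>x y e. P (\<Sum>i<n. elem_tensor sE x0 (x i) (y i) (e i)) (\<Sum>i<n. (f (x i) - f (y i)) (e i)))
     \<longleftrightarrow> (\<forall>ts. P (tensor_of sE x0 ts) (pairing f ts))"
proof safe
  fix ts
  assume "\<forall>n::nat. \<forall>x y e. P (\<Sum>i<n. elem_tensor sE x0 (x i) (y i) (e i)) (\<Sum>i<n. (f (x i) - f (y i)) (e i))"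
  from this[rule_format, of "\<lambda>i. fst (ts ! i)" "\<lambda>i. fst (snd (ts ! i))" "\<lambda>i. snd (snd (ts ! i))" "length ts"]
  show "P (tensor_of sE x0 ts) (pairing f ts)"
    by (simp add: tensor_of_def pairing_def sum_list_sum_nth case_prod_beta atLeast0LessThan)
next
  fix n :: nat and x y e
  assume "\<forall>ts. P (tensor_of sE x0 ts) (pairing f ts)"
  from this[rule_format, of "map (\<lambda>i. (x i, y i, e i)) [0..<n]"]
  show "P (\<Sum>i<n. elem_tensor sE x0 (x i) (y i) (e i)) (\<Sum>i<n. (f (x i) - f (y i)) (e i))"
    by (simp add: tensor_of_def pairing_def o_def interv_sum_list_conv_sum_set_nat atLeast0LessThan)
qed

lemma alpha_bound_iff_lists:
  "alpha_bound sE x0 \<alpha> f C \<longleftrightarrow> (\<forall>ts. norm (pairing f ts) \<le> C * \<alpha> (tensor_of sE x0 ts))"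
  unfolding alpha_bound_def
  by (rule all_finite_families_iff_all_lists[where P = "\<lambda>u k. norm k \<le> C * \<alpha> u"])

lemma Lambda_spec_iff_lists:
  "Lambda_spec sE x0 s' W N' \<iota> f \<phi> \<longleftrightarrow>
     \<phi> \<in> dual_space s' W N' \<and> (\<forall>ts. \<phi> (\<iota> (tensor_of sE x0 ts)) = pairing f ts)"
  unfolding Lambda_spec_def
  using all_finite_families_iff_all_lists[where P = "\<lambda>u k. \<phi> (\<iota> u) = k"] by simp

lemma Lip0_apply_linear:
  assumes "f \<in> Lip0 sE x0"
  shows "f x (e + e') = f x e + f x e'" "f x (sE c e) = c * f x e"
  using assms by (auto simp: Lip0_def dual_space_def linear_map_on_def subset_iff)

text \<open>
  Elementary tensors act only on \<open>Lip0\<close>, whose members take linear functionals as values.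
  Therefore they are linear in \<open>e\<close>, and scalars can be moved into \<open>e\<close>.
\<close>

lemma elem_tensor_add: "elem_tensor sE x0 x y (e + e') = elem_tensor sE x0 x y e + elem_tensor sE x0 x y e'"
  by (auto simp: elem_tensor_def fun_eq_iff Lip0_apply_linear algebra_simps)

lemma elem_tensor_scale: "elem_tensor sE x0 x y (sE c e) = fun_scale (*) c (elem_tensor sE x0 x y e)"
  by (auto simp: elem_tensor_def fun_eq_iff fun_scale_def Lip0_apply_linear algebra_simps)

lemma elem_tensor_via: "elem_tensor sE x0 x z e = elem_tensor sE x0 x y e + elem_tensor sE x0 y z e"
  by (auto simp: elem_tensor_def fun_eq_iff)

lemma elem_tensor_same: "elem_tensor sE x0 x x e = 0"
  by (auto simp: elem_tensor_def fun_eq_iff)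

text \<open>
  Scalar multiplication and negation of formal sums.  Negation exchanges the two points,
  since \<open>\<delta>\<^bsub>(y,x)\<^esub> \<boxtimes> e = - (\<delta>\<^bsub>(x,y)\<^esub> \<boxtimes> e)\<close>.
\<close>

definition scale_entries :: "('e \<Rightarrow> 'e) \<Rightarrow> ('x \<times> 'x \<times> 'e) list \<Rightarrow> ('x \<times> 'x \<times> 'e) list" where
  "scale_entries g ts = map (\<lambda>(x, y, e). (x, y, g e)) ts"

definition swap_points :: "('x \<times> 'x \<times> 'e) list \<Rightarrow> ('x \<times> 'x \<times> 'e) list" where
  "swap_points ts = map (\<lambda>(x, y, e). (y, x, e)) ts"

lemma tensor_of_scale_entries: "tensor_of sE x0 (scale_entries (sE c) ts) = fun_scale (*) c (tensor_of sE x0 ts)"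
  by (induction ts) (auto simp: scale_entries_def elem_tensor_scale fun_scale_def fun_eq_iff algebra_simps)

lemma pairing_scale_entries:
  assumes "range f \<subseteq> E_dual sE"
  shows "pairing f (scale_entries (sE c) ts) = c * pairing f ts"
proof -
  have "f x (sE c e) = c * f x e" for x e
    using assms by (auto simp: dual_space_def linear_map_on_def subset_iff)
  then show ?thesis
    by (induction ts) (auto simp: scale_entries_def algebra_simps)
qed

lemma tensor_of_swap_points: "tensor_of sE x0 (swap_points ts) = - tensor_of sE x0 ts"
  by (induction ts) (auto simp: swap_points_def elem_tensor_def fun_eq_iff)

lemma pairing_swap_points: "pairing f (swap_points ts) = - pairing f ts"
  by (induction ts) (auto simp: swap_points_def)

text \<open>
  In a linear combination of elementary tensors the coefficients are absorbed by the vectors \<open>e\<close>;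
  so plain sums already exhaust the span.
\<close>

lemma lip_tensor_eq_range:
  fixes sE :: "'k::real_normed_field \<Rightarrow> 'e::banach \<Rightarrow> 'e" and x0 :: "'x::metric_space"
  shows "lip_tensor sE x0 = range (tensor_of sE x0)"
proof -
  interpret S: vector_space "fun_scale (*) :: 'k \<Rightarrow> (('x \<Rightarrow> 'e \<Rightarrow> 'k) \<Rightarrow> 'k) \<Rightarrow> _"
    by (rule vector_space_fun_scale) (rule vector_space_over_itself.vector_space_axioms)
  show ?thesis
  proof (rule antisym)
    show "lip_tensor sE x0 \<subseteq> range (tensor_of sE x0)"
    proof
      fix u assume "u \<in> lip_tensor sE x0"
      then have "u \<in> S.span {elem_tensor sE x0 x y e | x y e. True}"
        by (simp add: lip_tensor_def)
      then show "u \<in> range (tensor_of sE x0)"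
      proof (induction rule: S.span_induct_alt)
        case base
        then show ?case by (rule range_eqI[of _ _ "[]"]) simp
      next
        case (step c t u)
        then obtain x y e ts where "t = elem_tensor sE x0 x y e" "u = tensor_of sE x0 ts" by blast
        then show ?case
          by (intro range_eqI[of _ _ "(x, y, sE c e) # ts"]) (simp add: elem_tensor_scale)
      qed
    qed
    have "tensor_of sE x0 ts \<in> S.span {elem_tensor sE x0 x y e | x y e. True}" for ts
    proof (induction ts)
      case Nil
      show ?case unfolding tensor_of_simps by (rule S.span_zero)
    next
      case (Cons t ts)
      then show ?case
        by (cases t) (auto simp del: plus_fun_apply intro!: S.span_add intro: S.span_base)
    qed
    then show "range (tensor_of sE x0) \<subseteq> lip_tensor sE x0"
      by (auto simp: lip_tensor_def)
  qed
qed

lemma tensor_of_mem: "tensor_of sE x0 ts \<in> lip_tensor sE x0"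
  by (simp add: lip_tensor_eq_range)

lemma elem_tensor_mem: "elem_tensor sE x0 x y e \<in> lip_tensor sE x0"
  using tensor_of_mem[of sE x0 "[(x, y, e)]"] by simp

section \<open>Lipschitz operators as functionals\<close>

locale completed_lip_tensor =
  completed "fun_scale (*)" "lip_tensor sE x0" \<alpha> sW W NW \<iota>
  for sE :: "'k::{real_normed_field, banach} \<Rightarrow> 'e::banach \<Rightarrow> 'e"
    and x0 :: "'x::metric_space"
    and \<alpha> :: "(('x \<Rightarrow> 'e \<Rightarrow> 'k) \<Rightarrow> 'k) \<Rightarrow> real"
    and sW :: "'k \<Rightarrow> 'w::ab_group_add \<Rightarrow> 'w"
    and W :: "'w set"
    and NW :: "'w \<Rightarrow> real"
    and \<iota> :: "(('x \<Rightarrow> 'e \<Rightarrow> 'k) \<Rightarrow> 'k) \<Rightarrow> 'w" +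
  assumes cross: "\<And>x y e. \<alpha> (elem_tensor sE x0 x y e) = dist x y * norm e"
begin

abbreviation "spec \<equiv> Lambda_spec sE x0 sW W NW \<iota>"

text \<open>
  Two formal sums of the same tensor have the same pairing with \<open>f\<close>: apply the bound to their
  formal difference, on which \<open>\<alpha>\<close> is \<open>0\<close>.
\<close>

lemma functional_of_operator:
  assumes f: "range f \<subseteq> E_dual sE" and "0 \<le> C" and bound: "alpha_bound sE x0 \<alpha> f C"
  obtains \<phi> where "\<phi> \<in> dual_space (fun_scale (*)) (lip_tensor sE x0) \<alpha>"
    "\<And>ts. \<phi> (tensor_of sE x0 ts) = pairing f ts"
proof -
  have well_defined: "pairing f ts = pairing f us" if eq: "tensor_of sE x0 ts = tensor_of sE x0 us" for ts us
  proof -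
    have "norm (pairing f (ts @ swap_points us)) \<le> C * \<alpha> (tensor_of sE x0 (ts @ swap_points us))"
      using bound unfolding alpha_bound_iff_lists by blast
    then show ?thesis
      by (simp add: tensor_of_swap_points pairing_swap_points eq V.N_zero)
  qed
  define \<phi> where "\<phi> u = (if u \<in> lip_tensor sE x0 then pairing f (SOME ts. tensor_of sE x0 ts = u) else 0)" for u
  have \<phi>: "\<phi> (tensor_of sE x0 ts) = pairing f ts" for ts
  proof -
    have "tensor_of sE x0 (SOME us. tensor_of sE x0 us = tensor_of sE x0 ts) = tensor_of sE x0 ts"
      by (rule someI) simp
    from well_defined[OF this] show ?thesis
      unfolding \<phi>_def by (simp only: tensor_of_mem if_True)
  qed
  have "\<phi> \<in> dual_space (fun_scale (*)) (lip_tensor sE x0) \<alpha>"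
  proof (rule V.dual_spaceI)
    fix u v assume "u \<in> lip_tensor sE x0" "v \<in> lip_tensor sE x0"
    then obtain ts us where "u = tensor_of sE x0 ts" "v = tensor_of sE x0 us"
      by (auto simp: lip_tensor_eq_range)
    then show "\<phi> (u + v) = \<phi> u + \<phi> v"
      using \<phi>[of "ts @ us"] by (simp add: \<phi>)
  next
    fix c u assume "u \<in> lip_tensor sE x0"
    then obtain ts where "u = tensor_of sE x0 ts"
      by (auto simp: lip_tensor_eq_range)
    then show "\<phi> (fun_scale (*) c u) = c * \<phi> u"
      using \<phi>[of "scale_entries (sE c) ts"] by (simp add: \<phi> tensor_of_scale_entries pairing_scale_entries[OF f])
  next
    fix u assume "u \<in> lip_tensor sE x0"
    then show "norm (\<phi> u) \<le> C * \<alpha> u"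
      using bound by (auto simp: lip_tensor_eq_range \<phi> alpha_bound_iff_lists)
  qed (simp add: \<phi>_def)
  then show ?thesis using \<phi> that by blast
qed

lemma spec_exists:
  assumes "f \<in> Lip_alpha sE x0 \<alpha>"
  shows "\<exists>\<phi>. spec f \<phi>"
proof -
  obtain C where f: "range f \<subseteq> E_dual sE" and C: "0 \<le> C" "alpha_bound sE x0 \<alpha> f C"
    using assms by (auto simp: Lip_alpha_def)
  obtain \<phi> where \<phi>: "\<phi> \<in> dual_space (fun_scale (*)) (lip_tensor sE x0) \<alpha>"
    "\<And>ts. \<phi> (tensor_of sE x0 ts) = pairing f ts"
    using functional_of_operator[OF f C] by blast
  obtain \<psi> where "\<psi> \<in> dual_space sW W NW" "\<And>v. v \<in> lip_tensor sE x0 \<Longrightarrow> \<psi> (\<iota> v) = \<phi> v"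
    using dual_extends[OF \<phi>(1)] by blast
  then have "spec f \<psi>"
    by (simp add: Lambda_spec_iff_lists \<phi>(2) tensor_of_mem)
  then show ?thesis by blast
qed

lemma spec_unique:
  assumes "spec f \<phi>" "spec f \<psi>"
  shows "\<phi> = \<psi>"
  using assms
  by (intro dual_eq_if_eq_on_range) (auto simp: Lambda_spec_iff_lists lip_tensor_eq_range)

text \<open>The map that turns out to be \<open>\<Lambda>\<inverse>\<close>.\<close>

definition operator_of :: "('w \<Rightarrow> 'k) \<Rightarrow> 'x \<Rightarrow> 'e \<Rightarrow> 'k" where
  "operator_of \<phi> x e = \<phi> (\<iota> (elem_tensor sE x0 x x0 e))"

lemma operator_of_diff:
  assumes "\<phi> \<in> dual_space sW W NW"
  shows "(operator_of \<phi> x - operator_of \<phi> y) e = \<phi> (\<iota> (elem_tensor sE x0 x y e))"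
  using elem_tensor_via[of sE x0 x x0 e y]
  by (simp add: operator_of_def \<iota>_add W.dual_add[OF assms] \<iota>_mem elem_tensor_mem)

lemma spec_operator_of:
  assumes \<phi>: "\<phi> \<in> dual_space sW W NW"
  shows "spec (operator_of \<phi>) \<phi>"
proof -
  have "\<phi> (\<iota> (tensor_of sE x0 ts)) = pairing (operator_of \<phi>) ts" for ts
  proof (induction ts)
    case Nil
    show ?case by (simp only: tensor_of_simps pairing_simps \<iota>_zero W.dual_zero[OF \<phi>])
  next
    case (Cons t ts)
    then show ?case
      by (cases t) (simp add: \<iota>_add \<iota>_mem elem_tensor_mem tensor_of_mem W.dual_add[OF \<phi>]
          operator_of_diff[OF \<phi>] del: minus_apply plus_fun_apply)
  qed
  then show ?thesis using \<phi> by (simp add: Lambda_spec_iff_lists)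
qed

lemma operator_of_spec:
  assumes "f \<in> Lip_alpha sE x0 \<alpha>" "spec f \<phi>"
  shows "operator_of \<phi> = f"
proof (intro ext)
  fix x e
  have "\<phi> (\<iota> (tensor_of sE x0 [(x, x0, e)])) = pairing f [(x, x0, e)]"
    using assms(2) unfolding Lambda_spec_iff_lists by blast
  then show "operator_of \<phi> x e = f x e"
    using assms(1) by (simp add: operator_of_def Lip_alpha_def)
qed

text \<open>
  On the dense image of \<open>X \<boxtimes> E\<close> the two conditions are the same, because \<open>\<iota>\<close> preserves norms; the
  passage to \<open>W\<close> keeps the constant.
\<close>

lemma alpha_bound_iff_functional_bound:
  assumes spec: "spec f \<phi>" and "0 \<le> C"
  shows "alpha_bound sE x0 \<alpha> f C \<longleftrightarrow> (\<forall>w\<in>W. norm (\<phi> w) \<le> C * NW w)"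
proof
  have \<phi>: "\<phi> \<in> dual_space sW W NW" and eq: "\<And>ts. \<phi> (\<iota> (tensor_of sE x0 ts)) = pairing f ts"
    using spec by (auto simp: Lambda_spec_iff_lists)
  {
    assume "alpha_bound sE x0 \<alpha> f C"
    then have "norm (\<phi> (\<iota> v)) \<le> C * \<alpha> v" if "v \<in> lip_tensor sE x0" for v
      using that by (auto simp: alpha_bound_iff_lists lip_tensor_eq_range eq)
    then show "\<forall>w\<in>W. norm (\<phi> w) \<le> C * NW w"
      using bound_extends[OF \<phi> \<open>0 \<le> C\<close>] by blast
  next
    assume "\<forall>w\<in>W. norm (\<phi> w) \<le> C * NW w"
    then show "alpha_bound sE x0 \<alpha> f C"
      by (metis alpha_bound_iff_lists eq \<iota>_mem \<iota>_norm tensor_of_mem)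
  }
qed

lemma Lip_alpha_norm_eq_dual_norm:
  assumes "spec f \<phi>"
  shows "Lip_alpha_norm sE x0 \<alpha> f = dual_norm W NW \<phi>"
proof -
  have "{C. 0 \<le> C \<and> alpha_bound sE x0 \<alpha> f C} = {C. 0 \<le> C \<and> (\<forall>w\<in>W. norm (\<phi> w) \<le> C * NW w)}"
    using alpha_bound_iff_functional_bound[OF assms] by blast
  then show ?thesis
    using W.Inf_bounds_eq_dual_norm[of \<phi>] assms by (simp add: Lip_alpha_norm_def Lambda_spec_def)
qed

text \<open>
  Boundedness of \<open>f x\<close> on \<open>E\<close> is where the cross-norm identity enters, with the constant
  \<open>\<parallel>\<phi>\<parallel> d(x,x0)\<close>; the constant \<open>\<parallel>\<phi>\<parallel>\<close> serves for the \<open>\<alpha>\<close>-bound.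
\<close>

lemma operator_of_mem:
  assumes \<phi>: "\<phi> \<in> dual_space sW W NW"
  shows "operator_of \<phi> \<in> Lip_alpha sE x0 \<alpha>"
proof -
  have "operator_of \<phi> x \<in> E_dual sE" for x
  proof -
    have "norm (operator_of \<phi> x e) \<le> (dual_norm W NW \<phi> * dist x x0) * norm e" for e
      using W.norm_le_dual_norm[OF \<phi> \<iota>_mem[OF elem_tensor_mem[of sE x0 x x0 e]]]
      by (simp add: operator_of_def \<iota>_norm elem_tensor_mem cross mult.assoc)
    then show ?thesis
      by (auto simp: dual_space_def linear_map_on_def operator_of_def elem_tensor_add elem_tensor_scale
          \<iota>_add \<iota>_scale \<iota>_mem elem_tensor_mem W.dual_add[OF \<phi>] W.dual_scale[OF \<phi>])
  qed
  moreover have "operator_of \<phi> x0 = 0"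
    by (simp add: fun_eq_iff operator_of_def elem_tensor_same \<iota>_zero W.dual_zero[OF \<phi>])
  moreover have "alpha_bound sE x0 \<alpha> (operator_of \<phi>) (dual_norm W NW \<phi>)"
    using alpha_bound_iff_functional_bound[OF spec_operator_of[OF \<phi>] W.dual_norm_nonneg[OF \<phi>]]
      W.norm_le_dual_norm[OF \<phi>] by blast
  ultimately show ?thesis
    using W.dual_norm_nonneg[OF \<phi>] by (auto simp: Lip_alpha_def)
qed

abbreviation "\<Lambda> \<equiv> Lambda sE x0 sW W NW \<iota>"

lemma spec_Lambda:
  assumes "f \<in> Lip_alpha sE x0 \<alpha>"
  shows "spec f (\<Lambda> f)"
  unfolding Lambda_def using spec_exists[OF assms] spec_unique by (metis theI)

lemma Lambda_mem: "f \<in> Lip_alpha sE x0 \<alpha> \<Longrightarrow> \<Lambda> f \<in> dual_space sW W NW"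
  using spec_Lambda by (simp add: Lambda_spec_def)

lemma operator_of_Lambda: "f \<in> Lip_alpha sE x0 \<alpha> \<Longrightarrow> operator_of (\<Lambda> f) = f"
  using operator_of_spec spec_Lambda by blast

lemma Lambda_operator_of: "\<phi> \<in> dual_space sW W NW \<Longrightarrow> \<Lambda> (operator_of \<phi>) = \<phi>"
  using spec_unique spec_Lambda operator_of_mem spec_operator_of by blast

lemma bij_betw_Lambda: "bij_betw \<Lambda> (Lip_alpha sE x0 \<alpha>) (dual_space sW W NW)"
  by (rule bij_betw_byWitness[of _ operator_of])
    (auto simp: operator_of_Lambda Lambda_operator_of Lambda_mem operator_of_mem)

text \<open>
  Since \<open>operator_of\<close> is linear by its formula and is a two-sided inverse of \<open>\<Lambda>\<close>, the map \<open>\<Lambda>\<close> is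
  linear and its domain is a subspace: \<open>f + g\<close> is the image of \<open>\<Lambda> f + \<Lambda> g\<close>, and likewise for
  multiples.
\<close>

lemma operator_of_add: "operator_of (\<phi> + \<psi>) = operator_of \<phi> + operator_of \<psi>"
  by (simp add: operator_of_def fun_eq_iff)

lemma operator_of_scale: "operator_of (fun_scale (*) c \<phi>) = fun_scale (fun_scale (*)) c (operator_of \<phi>)"
  by (simp add: operator_of_def fun_scale_def fun_eq_iff)

lemma Lip_alpha_add:
  assumes "f \<in> Lip_alpha sE x0 \<alpha>" "g \<in> Lip_alpha sE x0 \<alpha>"
  shows "f + g \<in> Lip_alpha sE x0 \<alpha>" "\<Lambda> (f + g) = \<Lambda> f + \<Lambda> g"
proof -
  have mem: "\<Lambda> f + \<Lambda> g \<in> dual_space sW W NW"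
    using assms by (intro W.dual_add_mem Lambda_mem)
  moreover have eq: "operator_of (\<Lambda> f + \<Lambda> g) = f + g"
    using assms by (simp add: operator_of_add operator_of_Lambda)
  ultimately show "f + g \<in> Lip_alpha sE x0 \<alpha>" "\<Lambda> (f + g) = \<Lambda> f + \<Lambda> g"
    using operator_of_mem[OF mem] Lambda_operator_of[OF mem] by simp_all
qed

lemma Lip_alpha_scale:
  assumes "f \<in> Lip_alpha sE x0 \<alpha>"
  shows "fun_scale (fun_scale (*)) c f \<in> Lip_alpha sE x0 \<alpha>"
    "\<Lambda> (fun_scale (fun_scale (*)) c f) = fun_scale (*) c (\<Lambda> f)"
proof -
  have mem: "fun_scale (*) c (\<Lambda> f) \<in> dual_space sW W NW"
    using assms by (intro W.dual_scale_mem Lambda_mem)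
  moreover have eq: "operator_of (fun_scale (*) c (\<Lambda> f)) = fun_scale (fun_scale (*)) c f"
    using assms by (simp add: operator_of_scale operator_of_Lambda)
  ultimately show "fun_scale (fun_scale (*)) c f \<in> Lip_alpha sE x0 \<alpha>"
    "\<Lambda> (fun_scale (fun_scale (*)) c f) = fun_scale (*) c (\<Lambda> f)"
    using operator_of_mem[OF mem] Lambda_operator_of[OF mem] by simp_all
qed

lemma Lambda_isometric: "f \<in> Lip_alpha sE x0 \<alpha> \<Longrightarrow> dual_norm W NW (\<Lambda> f) = Lip_alpha_norm sE x0 \<alpha> f"
  by (rule Lip_alpha_norm_eq_dual_norm[OF spec_Lambda, symmetric])

lemma Lip_alpha_zero: "0 \<in> Lip_alpha sE x0 \<alpha>" "\<Lambda> 0 = 0"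
proof -
  interpret D: normed_carrier "fun_scale (*)" "dual_space sW W NW" "dual_norm W NW"
    by unfold_locales (rule W.normed_space_dual)
  have "operator_of 0 = 0"
    by (simp add: operator_of_def fun_eq_iff)
  then show "0 \<in> Lip_alpha sE x0 \<alpha>" "\<Lambda> 0 = 0"
    using operator_of_mem[OF D.zero_mem] Lambda_operator_of[OF D.zero_mem] by simp_all
qed

text \<open>The norm axioms are pulled back along the injective linear map \<open>\<Lambda>\<close>, which carries
  \<open>Lip_alpha_norm\<close> to the dual norm.\<close>

lemma normed_space_Lip_alpha:
  "normed_space (fun_scale (fun_scale (*))) (Lip_alpha sE x0 \<alpha>) (Lip_alpha_norm sE x0 \<alpha>)"
proof -
  interpret D: normed_carrier "fun_scale (*)" "dual_space sW W NW" "dual_norm W NW"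
    by unfold_locales (rule W.normed_space_dual)
  interpret L: vector_space "fun_scale (fun_scale (*)) :: 'k \<Rightarrow> ('x \<Rightarrow> 'e \<Rightarrow> 'k) \<Rightarrow> _"
    by (intro vector_space_fun_scale) (rule vector_space_over_itself.vector_space_axioms)
  have "L.subspace (Lip_alpha sE x0 \<alpha>)"
    by (rule L.subspaceI) (auto intro: Lip_alpha_zero Lip_alpha_add Lip_alpha_scale)
  moreover have "\<Lambda> f = 0 \<longleftrightarrow> f = 0" if "f \<in> Lip_alpha sE x0 \<alpha>" for f
    using bij_betw_Lambda that Lip_alpha_zero by (metis bij_betw_imp_inj_on inj_onD)
  ultimately show ?thesis
    unfolding normed_space_def
    using L.vector_space_axioms
    by (auto simp: Lambda_isometric[symmetric] Lip_alpha_add Lip_alpha_scale Lambda_mem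
        D.N_nonneg D.N_eq_0 D.N_triangle D.N_scale)
qed

lemma isometric_isomorphism_Lambda:
  "isometric_isomorphism
     (fun_scale (fun_scale (*))) (Lip_alpha sE x0 \<alpha>) (Lip_alpha_norm sE x0 \<alpha>)
     (fun_scale (*)) (dual_space sW W NW) (dual_norm W NW) \<Lambda>"
  unfolding isometric_isomorphism_def linear_map_on_def
  using normed_space_Lip_alpha W.normed_space_dual bij_betw_Lambda
  by (auto simp: Lip_alpha_add Lip_alpha_scale Lambda_isometric)

lemma inv_into_Lambda:
  assumes "\<phi> \<in> dual_space sW W NW"
  shows "inv_into (Lip_alpha sE x0 \<alpha>) \<Lambda> \<phi> = operator_of \<phi>"
  using inv_into_f_f[OF bij_betw_imp_inj_on[OF bij_betw_Lambda] operator_of_mem[OF assms]]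
  by (simp add: Lambda_operator_of[OF assms])

end

theorem theorem3p1:
  fixes sE :: "'k::{real_normed_field, banach} \<Rightarrow> 'e::banach \<Rightarrow> 'e"
    and x0 :: "'x::metric_space"
    and \<alpha> :: "(('x \<Rightarrow> 'e \<Rightarrow> 'k) \<Rightarrow> 'k) \<Rightarrow> real"
    and sW :: "'k \<Rightarrow> 'w::ab_group_add \<Rightarrow> 'w"
    and W :: "'w set"
    and NW :: "'w \<Rightarrow> real"
    and \<iota> :: "(('x \<Rightarrow> 'e \<Rightarrow> 'k) \<Rightarrow> 'k) \<Rightarrow> 'w"
  assumes E: "normed_space sE UNIV norm"
    and \<alpha>: "lip_cross_norm sE x0 \<alpha>"
    and completion: "is_completion (fun_scale (*)) (lip_tensor sE x0) \<alpha> sW W NW \<iota>"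
  shows
    "(\<forall>f\<in>Lip_alpha sE x0 \<alpha>. \<exists>!\<phi>. Lambda_spec sE x0 sW W NW \<iota> f \<phi>) \<and>
     (\<forall>f\<in>Lip_alpha sE x0 \<alpha>. \<forall>n::nat. \<forall>x y e.
           Lambda sE x0 sW W NW \<iota> f (\<iota> (\<Sum>i<n. elem_tensor sE x0 (x i) (y i) (e i)))
             = (\<Sum>i<n. (f (x i) - f (y i)) (e i))) \<and>
     (isometric_isomorphism
           (fun_scale (fun_scale (*))) (Lip_alpha sE x0 \<alpha>) (Lip_alpha_norm sE x0 \<alpha>)
           (fun_scale (*)) (dual_space sW W NW) (dual_norm W NW)
           (Lambda sE x0 sW W NW \<iota>)) \<and>
     (\<forall>\<phi>\<in>dual_space sW W NW. \<forall>x e.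
           inv_into (Lip_alpha sE x0 \<alpha>) (Lambda sE x0 sW W NW \<iota>) \<phi> x e
             = \<phi> (\<iota> (elem_tensor sE x0 x x0 e)))"
proof -
  interpret completed_lip_tensor sE x0 \<alpha> sW W NW \<iota>
    using \<alpha> completion by unfold_locales (auto simp: lip_cross_norm_def)
  have "\<exists>!\<phi>. spec f \<phi>" if "f \<in> Lip_alpha sE x0 \<alpha>" for f
    using spec_exists[OF that] spec_unique by blast
  moreover have "\<Lambda> f (\<iota> (\<Sum>i<n. elem_tensor sE x0 (x i) (y i) (e i))) = (\<Sum>i<n. (f (x i) - f (y i)) (e i))"
    if "f \<in> Lip_alpha sE x0 \<alpha>" for f and n :: nat and x y e
    using spec_Lambda[OF that] unfolding Lambda_spec_def by blast
  moreover have "inv_into (Lip_alpha sE x0 \<alpha>) \<Lambda> \<phi> x e = \<phi> (\<iota> (elem_tensor sE x0 x x0 e))"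
    if "\<phi> \<in> dual_space sW W NW" for \<phi> x e
    by (simp add: inv_into_Lambda[OF that] operator_of_def)
  ultimately show ?thesis
    using isometric_isomorphism_Lambda by blast
qed

end
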